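(* Let $\mathcal{S}$ be a triangulated category containing all set-indexed coproducts, and let $(\mathcal{P},\mathcal{I})$ be a (stable) projective class in $\mathcal{S}$. If the projective class generates, then for every object $X$, $\operatorname{proj.dim}X+1$ is an upper bound for the length of $X$.
   Context: Cofibre sequence means exact triangle. For a class $\mathcal{P}$ of objects, $\mathcal{P}\text{-null}$ is the class of maps $X\to Y$ such that every composite $P\to X\to Y$ with $P$ in $\mathcal{P}$ is zero; for a class $\mathcal{I}$ of maps, $\mathcal{I}\text{-proj}$ is the class of objects $P$ such that every composite $P\to X\to Y$ with $X\to Y$ in $\mathcal{I}$ is zero. A projective class is a pair $(\mathcal{P},\mathcal{I})$ with $\mathcal{P}\text{-null}=\mathcal{I}$, $\mathcal{I}\text{-proj}=\mathcal{P}$, such that each object $X$ lies in a cofibre sequence $P\to X\to Y$ with $P$ in $\mathcal{P}$ and $X\to Y$ in $\mathcal{I}$. It is stable if $\mathcal{P}$ and $\mathcal{I}$ are closed under suspension and desuspension. It generates if for each non-zero $X$ there is $P$ in $\mathcal{P}$ with $\mathcal{S}(P,X)\ne 0$. $\operatorname{proj.dim}X$ is the length $m$ of the shortest projective resolution $0\leftarrow X\leftarrow P_0\leftarrow P_1\leftarrow\cdots\leftarrow P_m\leftarrow 0$ of $X$ with respect to the projective class: each $P_s$ is in $\mathcal{P}$, there is a map $P_0\to X$ and there are maps $P_{s+1}\to\Sigma P_s$ (maps $P_{s+1}\to P_s$ of degree $-1$; the shift is immaterial by stability), and the sequence becomes exact after applying the graded functor $\mathcal{S}(P,-)_*$ for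 each $P$ in $\mathcal{P}$; it is infinite if no finite resolution exists. Length: $\mathcal{P}_0$ is the class of zero objects, $\mathcal{P}_1=\mathcal{P}$, and inductively $\mathcal{P}_n$ is the class of retracts of objects $V$ in cofibre sequences $U\to V\to P$ with $U$ in $\mathcal{P}_{n-1}$ and $P$ in $\mathcal{P}$; the length of $X$ is the smallest $n$ with $X$ in $\mathcal{P}_n$ (infinite if there is none). *)

theory Defs
  imports "HOL-Algebra.Coset" "HOL-Library.Extended_Nat"
begin

section \<open>Categories and additive categories\<close>

record ('o, 'm) category_data =
  objs :: "'o set"
  arrs :: "'m set"
  src :: "'m \<Rightarrow> 'o"
  tgt :: "'m \<Rightarrow> 'o"
  ident :: "'o \<Rightarrow> 'm"
  cmp :: "'m \<Rightarrow> 'm \<Rightarrow> 'm" (infixr \<open>\<cdot>\<index>\<close> 70)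

definition Hom :: "('o, 'm, 'z) category_data_scheme \<Rightarrow> 'o \<Rightarrow> 'o \<Rightarrow> 'm set"
  where "Hom C A B = {f \<in> arrs C. src C f = A \<and> tgt C f = B}"

locale category =
  fixes C :: "('o, 'm, 'z) category_data_scheme" (structure)
  assumes src_closed: "f \<in> arrs C \<Longrightarrow> src C f \<in> objs C"
    and tgt_closed: "f \<in> arrs C \<Longrightarrow> tgt C f \<in> objs C"
    and ident_closed: "A \<in> objs C \<Longrightarrow> ident C A \<in> Hom C A A"
    and cmp_closed: "\<lbrakk>f \<in> Hom C A B; g \<in> Hom C B D\<rbrakk> \<Longrightarrow> g \<cdot> f \<in> Hom C A D"
    and cmp_assoc: "\<lbrakk>f \<in> Hom C A B; g \<in> Hom C B D; h \<in> Hom C D E\<rbrakk>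
                     \<Longrightarrow> (h \<cdot> g) \<cdot> f = h \<cdot> (g \<cdot> f)"
    and cmp_ident_right: "f \<in> Hom C A B \<Longrightarrow> f \<cdot> ident C A = f"
    and cmp_ident_left: "f \<in> Hom C A B \<Longrightarrow> ident C B \<cdot> f = f"

definition is_iso :: "('o, 'm, 'z) category_data_scheme \<Rightarrow> 'm \<Rightarrow> bool"
  where "is_iso C f \<longleftrightarrow> f \<in> arrs C \<and>
    (\<exists>g \<in> Hom C (tgt C f) (src C f).
        g \<cdot>\<^bsub>C\<^esub> f = ident C (src C f) \<and> f \<cdot>\<^bsub>C\<^esub> g = ident C (tgt C f))"

definition is_zero_object :: "('o, 'm, 'z) category_data_scheme \<Rightarrow> 'o \<Rightarrow> bool"
  where "is_zero_object C Z \<longleftrightarrow> Z \<in> objs C \<and>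
    (\<forall>A \<in> objs C. (\<exists>!f. f \<in> Hom C A Z) \<and> (\<exists>!f. f \<in> Hom C Z A))"

definition is_retract :: "('o, 'm, 'z) category_data_scheme \<Rightarrow> 'o \<Rightarrow> 'o \<Rightarrow> bool"
  where "is_retract C A B \<longleftrightarrow>
    A \<in> objs C \<and> (\<exists>i \<in> Hom C A B. \<exists>r \<in> Hom C B A. r \<cdot>\<^bsub>C\<^esub> i = ident C A)"

definition is_coproduct ::
  "('o, 'm, 'z) category_data_scheme \<Rightarrow> 'i set \<Rightarrow> ('i \<Rightarrow> 'o) \<Rightarrow> 'o \<Rightarrow> ('i \<Rightarrow> 'm) \<Rightarrow> bool"
  where "is_coproduct C I X K \<iota> \<longleftrightarrow> K \<in> objs C \<and> (\<forall>i\<in>I. \<iota> i \<in> Hom C (X i) K) \<and>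
    (\<forall>D \<in> objs C. \<forall>f. (\<forall>i\<in>I. f i \<in> Hom C (X i) D) \<longrightarrow>
       (\<exists>!h. h \<in> Hom C K D \<and> (\<forall>i\<in>I. h \<cdot>\<^bsub>C\<^esub> \<iota> i = f i)))"

text \<open>HOL has no universe of small sets; the type \<open>'i\<close> plays that role: the index sets are
  all sets of elements of \<open>'i\<close>. It is independent of the types of objects and arrows, since a
  category with coproducts indexed by its own set of arrows is a preorder.\<close>

definition has_coproducts :: "('o, 'm, 'z) category_data_scheme \<Rightarrow> 'i itself \<Rightarrow> bool"
  where "has_coproducts C (_ :: 'i itself) \<longleftrightarrow>
    (\<forall>(I :: 'i set) X. (\<forall>i\<in>I. X i \<in> objs C) \<longrightarrow> (\<exists>K \<iota>. is_coproduct C I X K \<iota>))"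

record ('o, 'm) additive_data = "('o, 'm) category_data" +
  addm :: "'m \<Rightarrow> 'm \<Rightarrow> 'm" (infixl \<open>\<oplus>\<^sub>m\<index>\<close> 65)
  zerom :: "'o \<Rightarrow> 'o \<Rightarrow> 'm"

definition hom_group :: "('o, 'm, 'z) additive_data_scheme \<Rightarrow> 'o \<Rightarrow> 'o \<Rightarrow> 'm monoid"
  where "hom_group C A B = \<lparr>carrier = Hom C A B, mult = addm C, one = zerom C A B\<rparr>"

definition negm :: "('o, 'm, 'z) additive_data_scheme \<Rightarrow> 'm \<Rightarrow> 'm"
  where "negm C f = inv\<^bsub>hom_group C (src C f) (tgt C f)\<^esub> f"

locale additive_category = category C
  for C :: "('o, 'm, 'z) additive_data_scheme" (structure) +
  assumes hom_comm_group: "\<lbrakk>A \<in> objs C; B \<in> objs C\<rbrakk> \<Longrightarrow> comm_group (hom_group C A B)"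
    and cmp_add_right: "\<lbrakk>f \<in> Hom C A B; f' \<in> Hom C A B; g \<in> Hom C B D\<rbrakk>
                         \<Longrightarrow> g \<cdot> (f \<oplus>\<^sub>m f') = (g \<cdot> f) \<oplus>\<^sub>m (g \<cdot> f')"
    and cmp_add_left: "\<lbrakk>f \<in> Hom C A B; g \<in> Hom C B D; g' \<in> Hom C B D\<rbrakk>
                        \<Longrightarrow> (g \<oplus>\<^sub>m g') \<cdot> f = (g \<cdot> f) \<oplus>\<^sub>m (g' \<cdot> f)"
    and zero_object: "\<exists>Z. is_zero_object C Z"
    and biproducts: "\<lbrakk>A \<in> objs C; B \<in> objs C\<rbrakk> \<Longrightarrow>
      \<exists>D \<in> objs C. \<exists>i \<in> Hom C A D. \<exists>j \<in> Hom C B D. \<exists>p \<in> Hom C D A. \<exists>q \<in> Hom C D B.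
        p \<cdot> i = ident C A \<and> q \<cdot> j = ident C B \<and> p \<cdot> j = zerom C B A \<and> q \<cdot> i = zerom C A B \<and>
        (i \<cdot> p) \<oplus>\<^sub>m (j \<cdot> q) = ident C D"

definition additive_endofunctor ::
  "('o, 'm, 'z) additive_data_scheme \<Rightarrow> ('o \<Rightarrow> 'o) \<Rightarrow> ('m \<Rightarrow> 'm) \<Rightarrow> bool"
  where "additive_endofunctor C Fo Fa \<longleftrightarrow>
    (\<forall>A \<in> objs C. Fo A \<in> objs C \<and> Fa (ident C A) = ident C (Fo A)) \<and>
    (\<forall>A B. \<forall>f \<in> Hom C A B. Fa f \<in> Hom C (Fo A) (Fo B)) \<and>
    (\<forall>A B D. \<forall>f \<in> Hom C A B. \<forall>g \<in> Hom C B D. Fa (g \<cdot>\<^bsub>C\<^esub> f) = Fa g \<cdot>\<^bsub>C\<^esub> Fa f) \<and>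
    (\<forall>A B. \<forall>f \<in> Hom C A B. \<forall>g \<in> Hom C A B. Fa (f \<oplus>\<^sub>m\<^bsub>C\<^esub> g) = Fa f \<oplus>\<^sub>m\<^bsub>C\<^esub> Fa g)"

definition natural_iso ::
  "('o, 'm, 'z) category_data_scheme \<Rightarrow> ('o \<Rightarrow> 'o) \<Rightarrow> ('m \<Rightarrow> 'm) \<Rightarrow> ('o \<Rightarrow> 'o) \<Rightarrow> ('m \<Rightarrow> 'm)
     \<Rightarrow> ('o \<Rightarrow> 'm) \<Rightarrow> bool"
  where "natural_iso C Fo Fa Go Ga \<eta> \<longleftrightarrow>
    (\<forall>A \<in> objs C. \<eta> A \<in> Hom C (Fo A) (Go A) \<and> is_iso C (\<eta> A)) \<and>
    (\<forall>A B. \<forall>f \<in> Hom C A B. \<eta> B \<cdot>\<^bsub>C\<^esub> Fa f = Ga f \<cdot>\<^bsub>C\<^esub> \<eta> A)"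

section \<open>Triangulated categories\<close>

text \<open>A triangle \<open>X \<rightarrow> Y \<rightarrow> Z \<rightarrow> \<Sigma>X\<close> is encoded by its three arrows \<open>(u, v, w)\<close>. The suspension
  is an additive self-equivalence, not necessarily an automorphism; \<open>desusp\<close> is a chosen
  quasi-inverse.\<close>

record ('o, 'm) triangulated_data = "('o, 'm) additive_data" +
  susp :: "'o \<Rightarrow> 'o"
  susp_arr :: "'m \<Rightarrow> 'm"
  desusp :: "'o \<Rightarrow> 'o"
  desusp_arr :: "'m \<Rightarrow> 'm"
  exact_triangles :: "('m \<times> 'm \<times> 'm) set"

definition is_triangle :: "('o, 'm, 'z) triangulated_data_scheme \<Rightarrow> 'm \<Rightarrow> 'm \<Rightarrow> 'm \<Rightarrow> bool"
  where "is_triangle S u v w \<longleftrightarrow>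
    (\<exists>X Y Z. u \<in> Hom S X Y \<and> v \<in> Hom S Y Z \<and> w \<in> Hom S Z (susp S X))"

definition triangle_map ::
  "('o, 'm, 'z) triangulated_data_scheme \<Rightarrow> 'm \<times> 'm \<times> 'm \<Rightarrow> 'm \<times> 'm \<times> 'm \<Rightarrow> 'm \<Rightarrow> 'm \<Rightarrow> 'm \<Rightarrow> bool"
  where "triangle_map S T T' a b c \<longleftrightarrow> (case (T, T') of ((u, v, w), (u', v', w')) \<Rightarrow>
    a \<in> Hom S (src S u) (src S u') \<and> b \<in> Hom S (src S v) (src S v') \<and>
    c \<in> Hom S (src S w) (src S w') \<and>
    b \<cdot>\<^bsub>S\<^esub> u = u' \<cdot>\<^bsub>S\<^esub> a \<and> c \<cdot>\<^bsub>S\<^esub> v = v' \<cdot>\<^bsub>S\<^esub> b \<and> susp_arr S a \<cdot>\<^bsub>S\<^esub> w = w' \<cdot>\<^bsub>S\<^esub> c)"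

locale triangulated_category = additive_category S
  for S :: "('o, 'm, 'z) triangulated_data_scheme" (structure) +
  assumes susp_functor: "additive_endofunctor S (susp S) (susp_arr S)"
    and desusp_functor: "additive_endofunctor S (desusp S) (desusp_arr S)"
    and susp_unit: "\<exists>\<eta>. natural_iso S id id (desusp S \<circ> susp S) (desusp_arr S \<circ> susp_arr S) \<eta>"
    and susp_counit: "\<exists>\<epsilon>. natural_iso S (susp S \<circ> desusp S) (susp_arr S \<circ> desusp_arr S) id id \<epsilon>"
    and exact_is_triangle: "(u, v, w) \<in> exact_triangles S \<Longrightarrow> is_triangle S u v w"
    and exact_iso_closed:
      "\<lbrakk>(u, v, w) \<in> exact_triangles S; is_triangle S u' v' w';
        triangle_map S (u, v, w) (u', v', w') a b c; is_iso S a; is_iso S b; is_iso S c\<rbrakk>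
        \<Longrightarrow> (u', v', w') \<in> exact_triangles S"
    and exact_identity:
      "\<lbrakk>X \<in> objs S; is_zero_object S Z\<rbrakk>
        \<Longrightarrow> (ident S X, zerom S X Z, zerom S Z (susp S X)) \<in> exact_triangles S"
    and exact_completion: "u \<in> arrs S \<Longrightarrow> \<exists>v w. (u, v, w) \<in> exact_triangles S"
    and exact_rotation:
      "is_triangle S u v w \<Longrightarrow>
        (u, v, w) \<in> exact_triangles S \<longleftrightarrow> (v, w, negm S (susp_arr S u)) \<in> exact_triangles S"
    and exact_morphism:
      "\<lbrakk>(u, v, w) \<in> exact_triangles S; (u', v', w') \<in> exact_triangles S;
        a \<in> Hom S (src S u) (src S u'); b \<in> Hom S (src S v) (src S v'); b \<cdot> u = u' \<cdot> a\<rbrakk>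
        \<Longrightarrow> \<exists>c. triangle_map S (u, v, w) (u', v', w') a b c"
    and exact_octahedron:
      "\<lbrakk>f \<in> Hom S X Y; g \<in> Hom S Y Z;
        (f, f1, f2) \<in> exact_triangles S; (g, g1, g2) \<in> exact_triangles S;
        (g \<cdot> f, h1, h2) \<in> exact_triangles S\<rbrakk>
        \<Longrightarrow> \<exists>u v. u \<in> Hom S (tgt S f1) (tgt S h1) \<and> v \<in> Hom S (tgt S h1) (tgt S g1) \<and>
              (u, v, susp_arr S f1 \<cdot> g2) \<in> exact_triangles S \<and>
              u \<cdot> f1 = h1 \<cdot> g \<and> v \<cdot> h1 = g1 \<and> h2 \<cdot> u = f2 \<and> g2 \<cdot> v = susp_arr S f \<cdot> h2"

definition cofibre_sequence :: "('o, 'm, 'z) triangulated_data_scheme \<Rightarrow> 'm \<Rightarrow> 'm \<Rightarrow> bool"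
  where "cofibre_sequence S u v \<longleftrightarrow> (\<exists>w. (u, v, w) \<in> exact_triangles S)"

definition susp_pow :: "('o, 'm, 'z) triangulated_data_scheme \<Rightarrow> int \<Rightarrow> 'o \<Rightarrow> 'o"
  where "susp_pow S n A =
    (if 0 \<le> n then (susp S ^^ nat n) A else (desusp S ^^ nat (- n)) A)"

section \<open>Projective classes\<close>

definition null_maps :: "('o, 'm, 'z) triangulated_data_scheme \<Rightarrow> 'o set \<Rightarrow> 'm set"
  where "null_maps S \<P> = {f \<in> arrs S. \<forall>P \<in> \<P>. \<forall>h \<in> Hom S P (src S f).
    f \<cdot>\<^bsub>S\<^esub> h = zerom S P (tgt S f)}"

definition proj_objs :: "('o, 'm, 'z) triangulated_data_scheme \<Rightarrow> 'm set \<Rightarrow> 'o set"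
  where "proj_objs S \<I> = {P \<in> objs S. \<forall>f \<in> \<I>. \<forall>h \<in> Hom S P (src S f).
    f \<cdot>\<^bsub>S\<^esub> h = zerom S P (tgt S f)}"

definition projective_class ::
  "('o, 'm, 'z) triangulated_data_scheme \<Rightarrow> 'o set \<Rightarrow> 'm set \<Rightarrow> bool"
  where "projective_class S \<P> \<I> \<longleftrightarrow> null_maps S \<P> = \<I> \<and> proj_objs S \<I> = \<P> \<and>
    (\<forall>X \<in> objs S. \<exists>P \<in> \<P>. \<exists>Y \<in> objs S. \<exists>u \<in> Hom S P X. \<exists>v \<in> Hom S X Y.
       v \<in> \<I> \<and> cofibre_sequence S u v)"

definition stable_class ::
  "('o, 'm, 'z) triangulated_data_scheme \<Rightarrow> 'o set \<Rightarrow> 'm set \<Rightarrow> bool"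
  where "stable_class S \<P> \<I> \<longleftrightarrow>
    (\<forall>P \<in> \<P>. susp S P \<in> \<P> \<and> desusp S P \<in> \<P>) \<and>
    (\<forall>f \<in> \<I>. susp_arr S f \<in> \<I> \<and> desusp_arr S f \<in> \<I>)"

definition generates :: "('o, 'm, 'z) triangulated_data_scheme \<Rightarrow> 'o set \<Rightarrow> bool"
  where "generates S \<P> \<longleftrightarrow>
    (\<forall>X \<in> objs S. \<not> is_zero_object S X \<longrightarrow> (\<exists>P \<in> \<P>. Hom S P X \<noteq> {zerom S P X}))"

section \<open>Projective dimension and length\<close>

text \<open>The group \<open>S(P, Y)\<close> in degree \<open>n\<close> is \<open>S(\<Sigma>\<^sup>n P, Y)\<close>, so exactness of the graded groups is
  exactness of \<open>S(Q, -)\<close> for every \<open>Q = \<Sigma>\<^sup>n P\<close> with \<open>n\<close> an integer. With \<open>d s : P (s + 1) \<rightarrow> \<Sigma>(P s)\<close>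
  the two maps meeting at \<open>P s\<close> are composable after one suspension, e.g.
  \<open>P (s + 2) \<rightarrow> \<Sigma>(P (s + 1)) \<rightarrow> \<Sigma>\<Sigma>(P s)\<close>, and they are compared there.
  The last clause is exactness at \<open>P m\<close>, where \<open>0\<close> is mapped in.\<close>

definition projective_resolution ::
  "('o, 'm, 'z) triangulated_data_scheme \<Rightarrow> 'o set \<Rightarrow> 'o \<Rightarrow> nat \<Rightarrow> (nat \<Rightarrow> 'o) \<Rightarrow> 'm \<Rightarrow> (nat \<Rightarrow> 'm) \<Rightarrow> bool"
  where "projective_resolution S \<P> X m P e d \<longleftrightarrow>
    (\<forall>s\<le>m. P s \<in> \<P>) \<and> e \<in> Hom S (P 0) X \<and>
    (\<forall>s<m. d s \<in> Hom S (P (Suc s)) (susp S (P s))) \<and>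
    (\<forall>A \<in> \<P>. \<forall>n. let Q = susp_pow S n A in
       (\<lambda>h. e \<cdot>\<^bsub>S\<^esub> h) ` Hom S Q (P 0) = Hom S Q X \<and>
       (0 < m \<longrightarrow> (\<lambda>h. d 0 \<cdot>\<^bsub>S\<^esub> h) ` Hom S Q (P 1) =
          kernel (hom_group S Q (susp S (P 0))) (hom_group S Q (susp S X))
            (\<lambda>h. susp_arr S e \<cdot>\<^bsub>S\<^esub> h)) \<and>
       (\<forall>s. Suc s < m \<longrightarrow> (\<lambda>h. d (Suc s) \<cdot>\<^bsub>S\<^esub> h) ` Hom S Q (P (Suc (Suc s))) =
          kernel (hom_group S Q (susp S (P (Suc s)))) (hom_group S Q (susp S (susp S (P s))))
            (\<lambda>h. susp_arr S (d s) \<cdot>\<^bsub>S\<^esub> h)) \<and>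
       (case m of
          0 \<Rightarrow> inj_on (\<lambda>h. e \<cdot>\<^bsub>S\<^esub> h) (Hom S Q (P 0))
        | Suc k \<Rightarrow> inj_on (\<lambda>h. d k \<cdot>\<^bsub>S\<^esub> h) (Hom S Q (P m))))"

text \<open>In \<^typ>\<open>enat\<close>, the infimum of the empty set is \<open>\<infinity>\<close>.\<close>

definition proj_dim :: "('o, 'm, 'z) triangulated_data_scheme \<Rightarrow> 'o set \<Rightarrow> 'o \<Rightarrow> enat"
  where "proj_dim S \<P> X = Inf {enat m |m. \<exists>P e d. projective_resolution S \<P> X m P e d}"

fun length_class :: "('o, 'm, 'z) triangulated_data_scheme \<Rightarrow> 'o set \<Rightarrow> nat \<Rightarrow> 'o set"
  where
    "length_class S \<P> 0 = {X. is_zero_object S X}"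
  | "length_class S \<P> (Suc 0) = \<P>"
  | "length_class S \<P> (Suc (Suc n)) =
       {X. \<exists>V U P. \<exists>u \<in> Hom S U V. \<exists>v \<in> Hom S V P. is_retract S X V \<and>
             U \<in> length_class S \<P> (Suc n) \<and> P \<in> \<P> \<and> cofibre_sequence S u v}"

definition obj_length :: "('o, 'm, 'z) triangulated_data_scheme \<Rightarrow> 'o set \<Rightarrow> 'o \<Rightarrow> enat"
  where "obj_length S \<P> X = Inf {enat n |n. X \<in> length_class S \<P> n}"

end

theory Submission
  imports Defs
begin

text \<open>Call a map \<open>P\<close>-epi or \<open>P\<close>-monic if the functors \<open>S(Q, -)\<close> with \<open>Q\<close> in \<open>\<P>\<close> make it surjective
  or injective. Given a projective resolution of \<open>X\<close> of length \<open>m\<close>, complete the augmentation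
  to an exact triangle \<open>P\<^sub>0 \<rightarrow> X \<rightarrow> Y \<rightarrow> \<Sigma>P\<^sub>0\<close>. The augmentation is \<open>P\<close>-epi, so \<open>Y \<rightarrow> \<Sigma>P\<^sub>0\<close> is
  \<open>P\<close>-monic and identifies \<open>S(Q, Y)\<close> with the kernel of \<open>S(Q, \<Sigma>P\<^sub>0) \<rightarrow> S(Q, \<Sigma>X)\<close>. If \<open>m > 0\<close>, the
  differential \<open>P\<^sub>1 \<rightarrow> \<Sigma>P\<^sub>0\<close> therefore lifts to \<open>Y\<close>, and \<open>P\<^sub>1, \<dots>, P\<^sub>m\<close> resolve \<open>Y\<close>
  (\<open>resolves_shift\<close>). If \<open>m = 0\<close>, the kernel vanishes, so nothing in \<open>\<P>\<close> maps to \<open>Y\<close>, and \<open>Y\<close> is zero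
  because the class generates. Iterating yields an Adams tower
  \<open>X = Y\<^sub>0 \<rightarrow> Y\<^sub>1 \<rightarrow> \<dots> \<rightarrow> Y\<^sub>m\<^sub>+\<^sub>1\<close> that ends in a zero object and in which every map has its cofibre in \<open>\<P>\<close>
  (\<open>resolves_imp_tower\<close>).

  Now let \<open>A \<rightarrow> Y\<^sub>0\<close> be any map, and compose it with the maps of a tower. By the
  octahedral axiom, the cofibre of \<open>A \<rightarrow> Y\<^sub>k\<^sub>+\<^sub>1\<close> is an extension of an object of \<open>\<P>\<close> by the cofibre
  of \<open>A \<rightarrow> Y\<^sub>k\<close>. Such an extension raises the length by at most one, so if \<open>A \<rightarrow> Y\<^sub>0\<close> is an identity
  the cofibre of the composite from \<open>A\<close> to the end of the tower has length at most \<open>m + 1\<close>. That cofibre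
  is \<open>\<Sigma>A\<close>, since the end is zero. The tower is therefore desuspended first, so that \<open>A\<close> is \<open>\<Sigma>\<^sup>-\<^sup>1X\<close> and
  \<open>\<Sigma>A\<close> is \<open>X\<close> up to isomorphism (\<open>tower_composite_cofibre\<close>, \<open>tower_imp_length_class\<close>). The
  cofibres of the desuspended maps remain in \<open>\<P>\<close> by \<open>desusp_cofibre_proj\<close>.\<close>

section \<open>Arithmetic of arrows\<close>

context additive_category
begin

lemma Hom_objs:
  assumes "f \<in> Hom C A B"
  shows "A \<in> objs C" and "B \<in> objs C"
  using assms src_closed tgt_closed unfolding Hom_def by auto

lemma Hom_src_tgt [simp]:
  assumes "f \<in> Hom C A B"
  shows "src C f = A" and "tgt C f = B"
  using assms unfolding Hom_def by auto

lemma zero_closed: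
  assumes "A \<in> objs C" "B \<in> objs C"
  shows "zerom C A B \<in> Hom C A B"
proof -
  interpret G: comm_group "hom_group C A B" using hom_comm_group[OF assms] .
  show ?thesis using G.one_closed by (simp add: hom_group_def)
qed

lemma add_closed:
  assumes "f \<in> Hom C A B" "g \<in> Hom C A B"
  shows "f \<oplus>\<^sub>m g \<in> Hom C A B"
proof -
  interpret G: comm_group "hom_group C A B" using hom_comm_group Hom_objs[OF assms(1)] .
  show ?thesis using G.m_closed assms by (simp add: hom_group_def)
qed

lemma neg_closed:
  assumes "f \<in> Hom C A B"
  shows "negm C f \<in> Hom C A B"
proof -
  interpret G: comm_group "hom_group C A B" using hom_comm_group Hom_objs[OF assms(1)] .
  show ?thesis using G.inv_closed[of f] assms by (simp add: negm_def hom_group_def)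
qed

lemma add_zero:
  assumes "f \<in> Hom C A B"
  shows "f \<oplus>\<^sub>m zerom C A B = f" and "zerom C A B \<oplus>\<^sub>m f = f"
proof -
  interpret G: comm_group "hom_group C A B" using hom_comm_group Hom_objs[OF assms(1)] .
  show "f \<oplus>\<^sub>m zerom C A B = f" using G.r_one[of f] assms by (simp add: hom_group_def)
  show "zerom C A B \<oplus>\<^sub>m f = f" using G.l_one[of f] assms by (simp add: hom_group_def)
qed

lemma add_neg:
  assumes "f \<in> Hom C A B"
  shows "f \<oplus>\<^sub>m negm C f = zerom C A B" and "negm C f \<oplus>\<^sub>m f = zerom C A B"
proof -
  interpret G: comm_group "hom_group C A B" using hom_comm_group Hom_objs[OF assms(1)] .
  show "f \<oplus>\<^sub>m negm C f = zerom C A B"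
    using G.r_inv[of f] assms by (simp add: negm_def hom_group_def)
  show "negm C f \<oplus>\<^sub>m f = zerom C A B"
    using G.l_inv[of f] assms by (simp add: negm_def hom_group_def)
qed

lemma add_assoc:
  assumes "f \<in> Hom C A B" "g \<in> Hom C A B" "h \<in> Hom C A B"
  shows "(f \<oplus>\<^sub>m g) \<oplus>\<^sub>m h = f \<oplus>\<^sub>m (g \<oplus>\<^sub>m h)"
proof -
  interpret G: comm_group "hom_group C A B" using hom_comm_group Hom_objs[OF assms(1)] .
  show ?thesis using G.m_assoc[of f g h] assms by (simp add: hom_group_def)
qed

lemma idempotent_zero:
  assumes "f \<in> Hom C A B" "f \<oplus>\<^sub>m f = f"
  shows "f = zerom C A B"
proof -
  interpret G: comm_group "hom_group C A B" using hom_comm_group Hom_objs[OF assms(1)] .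
  show ?thesis using G.r_cancel_one[of f f] assms by (simp add: hom_group_def)
qed

lemma neg_unique:
  assumes "f \<in> Hom C A B" "g \<in> Hom C A B" "f \<oplus>\<^sub>m g = zerom C A B"
  shows "g = negm C f"
proof -
  interpret G: comm_group "hom_group C A B" using hom_comm_group Hom_objs[OF assms(1)] .
  show ?thesis using G.inv_equality[of g f] G.m_comm[of f g] assms
    by (simp add: hom_group_def negm_def)
qed

lemma neg_neg:
  assumes "f \<in> Hom C A B"
  shows "negm C (negm C f) = f"
  using neg_unique[OF neg_closed[OF assms] assms add_neg(2)[OF assms]] by simp

lemma neg_inject:
  assumes "f \<in> Hom C A B" "g \<in> Hom C A B" "negm C f = negm C g"
  shows "f = g"
proof -
  have "negm C (negm C f) = negm C (negm C g)" unfolding assms(3) ..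
  then show ?thesis unfolding neg_neg[OF assms(1)] neg_neg[OF assms(2)] .
qed

lemma add_neg_eq_zero_imp_eq:
  assumes "f \<in> Hom C A B" "g \<in> Hom C A B" "f \<oplus>\<^sub>m negm C g = zerom C A B"
  shows "f = g"
proof -
  have ng: "negm C g \<in> Hom C A B" using neg_closed assms by blast
  have "f = f \<oplus>\<^sub>m (negm C g \<oplus>\<^sub>m g)" using add_neg(2)[OF assms(2)] add_zero(1)[OF assms(1)] by simp
  also have "\<dots> = g" using add_assoc[OF assms(1) ng assms(2)] assms(3) add_zero(2)[OF assms(2)] by simp
  finally show ?thesis .
qed

lemma cmp_zero_right:
  assumes "g \<in> Hom C B D" "A \<in> objs C"
  shows "g \<cdot> zerom C A B = zerom C A D"
proof (rule idempotent_zero)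
  have z: "zerom C A B \<in> Hom C A B" using zero_closed Hom_objs assms by blast
  show "g \<cdot> zerom C A B \<in> Hom C A D" using cmp_closed[OF z assms(1)] .
  show "(g \<cdot> zerom C A B) \<oplus>\<^sub>m (g \<cdot> zerom C A B) = g \<cdot> zerom C A B"
    using cmp_add_right[OF z z assms(1)] add_zero[OF z] by simp
qed

lemma cmp_zero_left:
  assumes "f \<in> Hom C A B" "D \<in> objs C"
  shows "zerom C B D \<cdot> f = zerom C A D"
proof (rule idempotent_zero)
  have z: "zerom C B D \<in> Hom C B D" using zero_closed Hom_objs assms by blast
  show "zerom C B D \<cdot> f \<in> Hom C A D" using cmp_closed[OF assms(1) z] .
  show "(zerom C B D \<cdot> f) \<oplus>\<^sub>m (zerom C B D \<cdot> f) = zerom C B D \<cdot> f"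
    using cmp_add_left[OF assms(1) z z] add_zero[OF z] by simp
qed

lemma cmp_neg_right:
  assumes "f \<in> Hom C A B" "g \<in> Hom C B D"
  shows "g \<cdot> negm C f = negm C (g \<cdot> f)"
proof (rule neg_unique)
  have n: "negm C f \<in> Hom C A B" using neg_closed assms by blast
  show "g \<cdot> f \<in> Hom C A D" "g \<cdot> negm C f \<in> Hom C A D" using cmp_closed assms n by blast+
  show "(g \<cdot> f) \<oplus>\<^sub>m (g \<cdot> negm C f) = zerom C A D"
    using cmp_add_right[OF assms(1) n assms(2)] add_neg(1)[OF assms(1)]
      cmp_zero_right[OF assms(2) Hom_objs(1)[OF assms(1)]] by simp
qed

lemma cmp_neg_left:
  assumes "f \<in> Hom C A B" "g \<in> Hom C B D"
  shows "negm C g \<cdot> f = negm C (g \<cdot> f)"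
proof (rule neg_unique)
  have n: "negm C g \<in> Hom C B D" using neg_closed assms by blast
  show "g \<cdot> f \<in> Hom C A D" "negm C g \<cdot> f \<in> Hom C A D" using cmp_closed assms n by blast+
  show "(g \<cdot> f) \<oplus>\<^sub>m (negm C g \<cdot> f) = zerom C A D"
    using cmp_add_left[OF assms(1) assms(2) n] add_neg(1)[OF assms(2)]
      cmp_zero_left[OF assms(1) Hom_objs(2)[OF assms(2)]] by simp
qed

lemma neg_zero:
  assumes "A \<in> objs C" "B \<in> objs C"
  shows "negm C (zerom C A B) = zerom C A B"
  using neg_unique[OF zero_closed[OF assms] zero_closed[OF assms]] add_zero[OF zero_closed[OF assms]]
  by simp

lemma neg_eq_zero_imp_zero:
  assumes "f \<in> Hom C A B" "negm C f = zerom C A B"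
  shows "f = zerom C A B"
  using neg_neg[OF assms(1)] neg_zero[OF Hom_objs[OF assms(1)]] assms(2) by simp

lemma zero_object_iff:
  assumes "A \<in> objs C"
  shows "is_zero_object C A \<longleftrightarrow> ident C A = zerom C A A"
proof
  assume "is_zero_object C A"
  then show "ident C A = zerom C A A"
    using assms ident_closed[OF assms] zero_closed[OF assms assms] unfolding is_zero_object_def by blast
next
  assume id: "ident C A = zerom C A A"
  have "f = zerom C B A" if "f \<in> Hom C B A" for f B
    using cmp_ident_left[OF that] cmp_zero_left[OF that assms] id by simp
  moreover have "f = zerom C A B" if "f \<in> Hom C A B" for f B
    using cmp_ident_right[OF that] cmp_zero_right[OF that assms] id by simp
  ultimately show "is_zero_object C A"
    unfolding is_zero_object_def using assms zero_closed by blast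
qed

lemma from_zero_object:
  assumes "is_zero_object C Z" "f \<in> Hom C Z B"
  shows "f = zerom C Z B"
  using assms zero_closed[OF Hom_objs[OF assms(2)]] Hom_objs(2)[OF assms(2)]
  unfolding is_zero_object_def by blast

lemma to_zero_object:
  assumes "is_zero_object C Z" "f \<in> Hom C A Z"
  shows "f = zerom C A Z"
  using assms zero_closed[OF Hom_objs[OF assms(2)]] Hom_objs(1)[OF assms(2)]
  unfolding is_zero_object_def by blast

lemma retract_refl: "A \<in> objs C \<Longrightarrow> is_retract C A A"
  unfolding is_retract_def using ident_closed cmp_ident_left by blast

lemma retract_trans:
  assumes "is_retract C A B" "is_retract C B D"
  shows "is_retract C A D"
proof -
  obtain i r where ir: "i \<in> Hom C A B" "r \<in> Hom C B A" "r \<cdot> i = ident C A"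
    using assms(1) unfolding is_retract_def by blast
  obtain j q where jq: "j \<in> Hom C B D" "q \<in> Hom C D B" "q \<cdot> j = ident C B"
    using assms(2) unfolding is_retract_def by blast
  have "(r \<cdot> q) \<cdot> (j \<cdot> i) = r \<cdot> ((q \<cdot> j) \<cdot> i)"
    using cmp_assoc[OF cmp_closed[OF ir(1) jq(1)] jq(2) ir(2)] cmp_assoc[OF ir(1) jq(1) jq(2)] by simp
  also have "\<dots> = ident C A" using ir jq cmp_ident_left[OF ir(1)] by simp
  finally show ?thesis
    using cmp_closed[OF ir(1) jq(1)] cmp_closed[OF jq(2) ir(2)] assms(1)
    unfolding is_retract_def by blast
qed

text \<open>If \<open>n = g - 1\<close> squares to zero, then \<open>1 - n\<close> inverts \<open>g = 1 + n\<close>. An endomorphism of an exact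
  triangle that is the identity on two vertices is of this kind on the third.\<close>

lemma unipotent_imp_left_invertible:
  assumes g: "g \<in> Hom C A A" and n: "n = g \<oplus>\<^sub>m negm C (ident C A)"
    and sq: "n \<cdot> n = zerom C A A"
  obtains k where "k \<in> Hom C A A" "k \<cdot> g = ident C A"
proof
  have A: "A \<in> objs C" using Hom_objs g by blast
  have id: "ident C A \<in> Hom C A A" using ident_closed A .
  have nH: "n \<in> Hom C A A" unfolding n using add_closed g id neg_closed by blast
  have geq: "g = n \<oplus>\<^sub>m ident C A"
    unfolding n using g id by (simp add: add_assoc[OF g neg_closed[OF id] id] add_neg add_zero)
  have nn: "negm C n \<in> Hom C A A" using neg_closed nH .
  show k: "ident C A \<oplus>\<^sub>m negm C n \<in> Hom C A A" using add_closed id nn by blast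
  have "negm C n \<cdot> g = (negm C n \<cdot> n) \<oplus>\<^sub>m (negm C n \<cdot> ident C A)"
    unfolding geq using cmp_add_right nH id nn by blast
  also have "\<dots> = negm C n"
    using cmp_neg_left[OF nH nH] sq neg_zero[OF A A] cmp_ident_right[OF nn] add_zero[OF nn] by simp
  finally have 1: "negm C n \<cdot> g = negm C n" .
  have "(ident C A \<oplus>\<^sub>m negm C n) \<cdot> g = g \<oplus>\<^sub>m negm C n"
    using cmp_add_left[OF g id nn] 1 cmp_ident_left[OF g] by simp
  also have "\<dots> = ident C A"
  proof -
    have "n \<oplus>\<^sub>m ident C A = ident C A \<oplus>\<^sub>m n"
    proof -
      interpret G: comm_group "hom_group C A A" using hom_comm_group A by blast
      show ?thesis using G.m_comm[of n "ident C A"] nH id by (simp add: hom_group_def)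
    qed
    then show ?thesis unfolding geq using add_assoc[OF id nH nn] add_neg(1)[OF nH] add_zero(1)[OF id] by simp
  qed
  finally show "(ident C A \<oplus>\<^sub>m negm C n) \<cdot> g = ident C A" .
qed

end

section \<open>Suspension and exact triangles\<close>

context triangulated_category
begin

lemma susp_objs: "A \<in> objs S \<Longrightarrow> susp S A \<in> objs S"
  and susp_ident: "A \<in> objs S \<Longrightarrow> susp_arr S (ident S A) = ident S (susp S A)"
  and susp_Hom: "f \<in> Hom S A B \<Longrightarrow> susp_arr S f \<in> Hom S (susp S A) (susp S B)"
  and susp_cmp: "f \<in> Hom S A B \<Longrightarrow> g \<in> Hom S B D \<Longrightarrow>
    susp_arr S (g \<cdot> f) = susp_arr S g \<cdot> susp_arr S f"
  and susp_add: "f \<in> Hom S A B \<Longrightarrow> h \<in> Hom S A B \<Longrightarrow>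
    susp_arr S (f \<oplus>\<^sub>m h) = susp_arr S f \<oplus>\<^sub>m susp_arr S h"
  using susp_functor unfolding additive_endofunctor_def by blast+

lemma desusp_objs: "A \<in> objs S \<Longrightarrow> desusp S A \<in> objs S"
  and desusp_ident: "A \<in> objs S \<Longrightarrow> desusp_arr S (ident S A) = ident S (desusp S A)"
  and desusp_Hom: "f \<in> Hom S A B \<Longrightarrow> desusp_arr S f \<in> Hom S (desusp S A) (desusp S B)"
  and desusp_add: "f \<in> Hom S A B \<Longrightarrow> h \<in> Hom S A B \<Longrightarrow>
    desusp_arr S (f \<oplus>\<^sub>m h) = desusp_arr S f \<oplus>\<^sub>m desusp_arr S h"
  using desusp_functor unfolding additive_endofunctor_def by blast+

lemma susp_zero:
  assumes "A \<in> objs S" "B \<in> objs S"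
  shows "susp_arr S (zerom S A B) = zerom S (susp S A) (susp S B)"
proof (rule idempotent_zero)
  have z: "zerom S A B \<in> Hom S A B" using zero_closed assms .
  show "susp_arr S (zerom S A B) \<in> Hom S (susp S A) (susp S B)" using susp_Hom z .
  show "susp_arr S (zerom S A B) \<oplus>\<^sub>m susp_arr S (zerom S A B) = susp_arr S (zerom S A B)"
    using susp_add[OF z z] add_zero[OF z] by simp
qed

lemma desusp_zero:
  assumes "A \<in> objs S" "B \<in> objs S"
  shows "desusp_arr S (zerom S A B) = zerom S (desusp S A) (desusp S B)"
proof (rule idempotent_zero)
  have z: "zerom S A B \<in> Hom S A B" using zero_closed assms .
  show "desusp_arr S (zerom S A B) \<in> Hom S (desusp S A) (desusp S B)" using desusp_Hom z .
  show "desusp_arr S (zerom S A B) \<oplus>\<^sub>m desusp_arr S (zerom S A B) = desusp_arr S (zerom S A B)"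
    using desusp_add[OF z z] add_zero[OF z] by simp
qed

lemma susp_zero_object: "is_zero_object S Z \<Longrightarrow> is_zero_object S (susp S Z)"
  using zero_object_iff[of Z] zero_object_iff[of "susp S Z"] susp_objs[of Z] susp_ident[of Z]
    susp_zero[of Z Z] unfolding is_zero_object_def by auto

lemma desusp_zero_object: "is_zero_object S Z \<Longrightarrow> is_zero_object S (desusp S Z)"
  using zero_object_iff[of Z] zero_object_iff[of "desusp S Z"] desusp_objs[of Z] desusp_ident[of Z]
    desusp_zero[of Z Z] unfolding is_zero_object_def by auto

text \<open>A natural isomorphism \<open>\<eta>\<close> from the identity to \<open>\<Sigma>\<^sup>-\<^sup>1\<Sigma>\<close>, carried along with its inverse \<open>\<theta>\<close>.\<close>

definition unit_pair where
  "unit_pair \<eta> \<theta> \<longleftrightarrow>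
     (\<forall>A \<in> objs S. \<eta> A \<in> Hom S A (desusp S (susp S A))) \<and>
     (\<forall>A \<in> objs S. \<theta> A \<in> Hom S (desusp S (susp S A)) A) \<and>
     (\<forall>A \<in> objs S. \<theta> A \<cdot> \<eta> A = ident S A) \<and>
     (\<forall>A \<in> objs S. \<eta> A \<cdot> \<theta> A = ident S (desusp S (susp S A))) \<and>
     (\<forall>A B. \<forall>f \<in> Hom S A B. \<eta> B \<cdot> f = desusp_arr S (susp_arr S f) \<cdot> \<eta> A)"

lemma unit_pairD:
  assumes "unit_pair \<eta> \<theta>"
  shows
    "\<And>A. A \<in> objs S \<Longrightarrow> \<eta> A \<in> Hom S A (desusp S (susp S A))"
    "\<And>A. A \<in> objs S \<Longrightarrow> \<theta> A \<in> Hom S (desusp S (susp S A)) A"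
    "\<And>A. A \<in> objs S \<Longrightarrow> \<theta> A \<cdot> \<eta> A = ident S A"
    "\<And>A. A \<in> objs S \<Longrightarrow> \<eta> A \<cdot> \<theta> A = ident S (desusp S (susp S A))"
    "\<And>A B f. f \<in> Hom S A B \<Longrightarrow> \<eta> B \<cdot> f = desusp_arr S (susp_arr S f) \<cdot> \<eta> A"
  using assms unfolding unit_pair_def by blast+

lemma unit_iso:
  obtains \<eta> \<theta> where "unit_pair \<eta> \<theta>"
proof -
  obtain \<eta> where n: "natural_iso S id id (desusp S \<circ> susp S) (desusp_arr S \<circ> susp_arr S) \<eta>"
    using susp_unit by blast
  have H: "\<eta> A \<in> Hom S A (desusp S (susp S A))" if "A \<in> objs S" for A
    using n that unfolding natural_iso_def by simp
  have "\<exists>t. t \<in> Hom S (desusp S (susp S A)) A \<and> t \<cdot> \<eta> A = ident S A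
      \<and> \<eta> A \<cdot> t = ident S (desusp S (susp S A))" if "A \<in> objs S" for A
  proof -
    have "is_iso S (\<eta> A)" using n that unfolding natural_iso_def by blast
    then show ?thesis unfolding is_iso_def Hom_src_tgt[OF H[OF that]] by blast
  qed
  then obtain \<theta> where t: "\<And>A. A \<in> objs S \<Longrightarrow> \<theta> A \<in> Hom S (desusp S (susp S A)) A \<and>
      \<theta> A \<cdot> \<eta> A = ident S A \<and> \<eta> A \<cdot> \<theta> A = ident S (desusp S (susp S A))" by metis
  show thesis
  proof (rule that, unfold unit_pair_def, intro conjI ballI allI)
    show "\<eta> B \<cdot> f = desusp_arr S (susp_arr S f) \<cdot> \<eta> A" if "f \<in> Hom S A B" for A B f
      using n that unfolding natural_iso_def by simp
  qed (use H t in auto)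
qed

text \<open>A natural isomorphism \<open>\<epsilon>\<close> from \<open>\<Sigma>\<Sigma>\<^sup>-\<^sup>1\<close> to the identity, with inverse \<open>\<delta>\<close>.\<close>

definition counit_pair where
  "counit_pair \<epsilon> \<delta> \<longleftrightarrow>
     (\<forall>A \<in> objs S. \<epsilon> A \<in> Hom S (susp S (desusp S A)) A) \<and>
     (\<forall>A \<in> objs S. \<delta> A \<in> Hom S A (susp S (desusp S A))) \<and>
     (\<forall>A \<in> objs S. \<epsilon> A \<cdot> \<delta> A = ident S A) \<and>
     (\<forall>A \<in> objs S. \<delta> A \<cdot> \<epsilon> A = ident S (susp S (desusp S A))) \<and>
     (\<forall>A B. \<forall>f \<in> Hom S A B. \<epsilon> B \<cdot> susp_arr S (desusp_arr S f) = f \<cdot> \<epsilon> A) \<and>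
     (\<forall>A B. \<forall>f \<in> Hom S A B. \<delta> B \<cdot> f = susp_arr S (desusp_arr S f) \<cdot> \<delta> A)"

lemma counit_pairD:
  assumes "counit_pair \<epsilon> \<delta>"
  shows
    "\<And>A. A \<in> objs S \<Longrightarrow> \<epsilon> A \<in> Hom S (susp S (desusp S A)) A"
    "\<And>A. A \<in> objs S \<Longrightarrow> \<delta> A \<in> Hom S A (susp S (desusp S A))"
    "\<And>A. A \<in> objs S \<Longrightarrow> \<epsilon> A \<cdot> \<delta> A = ident S A"
    "\<And>A. A \<in> objs S \<Longrightarrow> \<delta> A \<cdot> \<epsilon> A = ident S (susp S (desusp S A))"
    "\<And>A B f. f \<in> Hom S A B \<Longrightarrow> \<epsilon> B \<cdot> susp_arr S (desusp_arr S f) = f \<cdot> \<epsilon> A"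
    "\<And>A B f. f \<in> Hom S A B \<Longrightarrow> \<delta> B \<cdot> f = susp_arr S (desusp_arr S f) \<cdot> \<delta> A"
  using assms unfolding counit_pair_def by blast+

lemma counit_iso:
  obtains \<epsilon> \<delta> where "counit_pair \<epsilon> \<delta>"
proof -
  obtain \<epsilon> where n: "natural_iso S (susp S \<circ> desusp S) (susp_arr S \<circ> desusp_arr S) id id \<epsilon>"
    using susp_counit by blast
  have H: "\<epsilon> A \<in> Hom S (susp S (desusp S A)) A" if "A \<in> objs S" for A
    using n that unfolding natural_iso_def by simp
  have "\<exists>t. t \<in> Hom S A (susp S (desusp S A)) \<and> \<epsilon> A \<cdot> t = ident S A
      \<and> t \<cdot> \<epsilon> A = ident S (susp S (desusp S A))" if "A \<in> objs S" for A
  proof -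
    have "is_iso S (\<epsilon> A)" using n that unfolding natural_iso_def by blast
    then show ?thesis unfolding is_iso_def Hom_src_tgt[OF H[OF that]] by blast
  qed
  then obtain \<delta> where t: "\<And>A. A \<in> objs S \<Longrightarrow> \<delta> A \<in> Hom S A (susp S (desusp S A)) \<and>
      \<epsilon> A \<cdot> \<delta> A = ident S A \<and> \<delta> A \<cdot> \<epsilon> A = ident S (susp S (desusp S A))" by metis
  have nat: "\<epsilon> B \<cdot> susp_arr S (desusp_arr S f) = f \<cdot> \<epsilon> A" if "f \<in> Hom S A B" for A B f
    using n that unfolding natural_iso_def by simp
  show thesis
  proof (rule that, unfold counit_pair_def, intro conjI ballI allI)
    show "\<delta> B \<cdot> f = susp_arr S (desusp_arr S f) \<cdot> \<delta> A" if f: "f \<in> Hom S A B" for A B f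
    proof -
      have AB: "A \<in> objs S" "B \<in> objs S" using Hom_objs f by blast+
      have sf: "susp_arr S (desusp_arr S f) \<in> Hom S (susp S (desusp S A)) (susp S (desusp S B))"
        using susp_Hom desusp_Hom f by blast
      have dA: "\<delta> A \<in> Hom S A (susp S (desusp S A))" and dB: "\<delta> B \<in> Hom S B (susp S (desusp S B))"
        using t AB by blast+
      have "\<delta> B \<cdot> f = \<delta> B \<cdot> ((f \<cdot> \<epsilon> A) \<cdot> \<delta> A)"
        using cmp_assoc[OF dA H[OF AB(1)] f] t[OF AB(1)] cmp_ident_right[OF f] by simp
      also have "\<dots> = \<delta> B \<cdot> (\<epsilon> B \<cdot> (susp_arr S (desusp_arr S f) \<cdot> \<delta> A))"
        using nat[OF f, symmetric] cmp_assoc[OF dA sf H[OF AB(2)]] by simp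
      also have "\<dots> = (\<delta> B \<cdot> \<epsilon> B) \<cdot> (susp_arr S (desusp_arr S f) \<cdot> \<delta> A)"
        using cmp_assoc[OF cmp_closed[OF dA sf] H[OF AB(2)] dB] by simp
      also have "\<dots> = susp_arr S (desusp_arr S f) \<cdot> \<delta> A"
        using t[OF AB(2)] cmp_ident_left[OF cmp_closed[OF dA sf]] by simp
      finally show ?thesis .
    qed
  qed (use H t nat in auto)
qed

lemma cancel_right:
  assumes "f \<in> Hom S B D" "g \<in> Hom S B D" "p \<in> Hom S A B" "q \<in> Hom S B A"
    "p \<cdot> q = ident S B" "f \<cdot> p = g \<cdot> p"
  shows "f = g"
proof -
  have "(f \<cdot> p) \<cdot> q = (g \<cdot> p) \<cdot> q" using assms(6) by simp
  then show ?thesis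
    using cmp_assoc[OF assms(4,3,1)] cmp_assoc[OF assms(4,3,2)] assms(5)
      cmp_ident_right[OF assms(1)] cmp_ident_right[OF assms(2)] by simp
qed

lemma cancel_left:
  assumes "f \<in> Hom S A B" "g \<in> Hom S A B" "p \<in> Hom S B D" "q \<in> Hom S D B"
    "q \<cdot> p = ident S B" "p \<cdot> f = p \<cdot> g"
  shows "f = g"
proof -
  have "q \<cdot> (p \<cdot> f) = q \<cdot> (p \<cdot> g)" using assms(6) by simp
  then show ?thesis
    using cmp_assoc[OF assms(1,3,4)] cmp_assoc[OF assms(2,3,4)] assms(5)
      cmp_ident_left[OF assms(1)] cmp_ident_left[OF assms(2)] by simp
qed

lemma susp_faithful:
  assumes f: "f \<in> Hom S A B" and g: "g \<in> Hom S A B" and eq: "susp_arr S f = susp_arr S g"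
  shows "f = g"
proof -
  obtain \<eta> \<theta> where "unit_pair \<eta> \<theta>" by (rule unit_iso)
  note u = unit_pairD[OF this]
  have "\<eta> B \<cdot> f = \<eta> B \<cdot> g" using u(5)[OF f] u(5)[OF g] eq by simp
  then show ?thesis using cancel_left[OF f g] u(1,2,3) Hom_objs(2)[OF f] by blast
qed

lemma desusp_faithful:
  assumes f: "f \<in> Hom S A B" and g: "g \<in> Hom S A B" and eq: "desusp_arr S f = desusp_arr S g"
  shows "f = g"
proof -
  obtain \<epsilon> \<delta> where "counit_pair \<epsilon> \<delta>" by (rule counit_iso)
  note u = counit_pairD[OF this]
  have "f \<cdot> \<epsilon> A = g \<cdot> \<epsilon> A" using u(5)[OF f] u(5)[OF g] eq by simp
  then show ?thesis using cancel_right[OF f g] u(1,2,3) Hom_objs(1)[OF f] by blast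
qed

text \<open>The preimage of \<open>c\<close> is \<open>\<Sigma>\<^sup>-\<^sup>1c\<close> transported along the unit; naturality shows that \<open>\<Sigma>\<^sup>-\<^sup>1\<close> does not
  distinguish its suspension from \<open>c\<close>, and \<open>\<Sigma>\<^sup>-\<^sup>1\<close> is faithful.\<close>

lemma susp_full:
  assumes c: "c \<in> Hom S (susp S A) (susp S B)" and A: "A \<in> objs S" and B: "B \<in> objs S"
  obtains k where "k \<in> Hom S A B" "susp_arr S k = c"
proof -
  obtain \<eta> \<theta> where "unit_pair \<eta> \<theta>" by (rule unit_iso)
  note u = unit_pairD[OF this]
  define k where "k = \<theta> B \<cdot> (desusp_arr S c \<cdot> \<eta> A)"
  have dc: "desusp_arr S c \<in> Hom S (desusp S (susp S A)) (desusp S (susp S B))"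
    using desusp_Hom c .
  have dcn: "desusp_arr S c \<cdot> \<eta> A \<in> Hom S A (desusp S (susp S B))"
    using cmp_closed u(1)[OF A] dc by blast
  have k: "k \<in> Hom S A B" unfolding k_def using cmp_closed dcn u(2)[OF B] by blast
  have "desusp_arr S (susp_arr S k) \<cdot> \<eta> A = \<eta> B \<cdot> k" using u(5)[OF k] by simp
  also have "\<dots> = desusp_arr S c \<cdot> \<eta> A"
    unfolding k_def using cmp_assoc[OF dcn u(2)[OF B] u(1)[OF B]] u(4)[OF B] cmp_ident_left[OF dcn]
    by simp
  finally have "desusp_arr S (susp_arr S k) = desusp_arr S c"
    using cancel_right[OF desusp_Hom[OF susp_Hom[OF k]] dc u(1)[OF A] u(2)[OF A] u(4)[OF A]] by blast
  then have "susp_arr S k = c" using desusp_faithful susp_Hom[OF k] c by blast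
  then show thesis using that k by blast
qed

definition triangle where
  "triangle X Y Z u v w \<longleftrightarrow> u \<in> Hom S X Y \<and> v \<in> Hom S Y Z \<and> w \<in> Hom S Z (susp S X) \<and>
     (u, v, w) \<in> exact_triangles S"

lemma triangleD:
  assumes "triangle X Y Z u v w"
  shows "u \<in> Hom S X Y" "v \<in> Hom S Y Z" "w \<in> Hom S Z (susp S X)" "(u, v, w) \<in> exact_triangles S"
  using assms unfolding triangle_def by blast+

lemma triangle_objs:
  assumes "triangle X Y Z u v w"
  shows "X \<in> objs S" "Y \<in> objs S" "Z \<in> objs S"
  using triangleD[OF assms] Hom_objs by blast+

lemma exact_imp_triangle:
  assumes "(u, v, w) \<in> exact_triangles S"
  obtains Z where "triangle (src S u) (tgt S u) Z u v w"
proof -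
  obtain X Y Z where "u \<in> Hom S X Y" "v \<in> Hom S Y Z" "w \<in> Hom S Z (susp S X)"
    using exact_is_triangle[OF assms] unfolding is_triangle_def by blast
  then show thesis using that assms unfolding triangle_def by simp
qed

lemma completion:
  assumes "u \<in> Hom S X Y"
  obtains Z v w where "triangle X Y Z u v w"
proof -
  have "u \<in> arrs S" using assms unfolding Hom_def by blast
  then obtain v w where "(u, v, w) \<in> exact_triangles S" using exact_completion by blast
  then obtain Z where "triangle (src S u) (tgt S u) Z u v w" by (rule exact_imp_triangle)
  then show thesis using that Hom_src_tgt[OF assms] by simp
qed

lemma rotate:
  assumes "triangle X Y Z u v w"
  shows "triangle Y Z (susp S X) v w (negm S (susp_arr S u))"
proof -
  note T = triangleD[OF assms]
  have "is_triangle S u v w" using T unfolding is_triangle_def by blast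
  then have "(v, w, negm S (susp_arr S u)) \<in> exact_triangles S" using exact_rotation T by blast
  then show ?thesis unfolding triangle_def using T neg_closed susp_Hom by blast
qed

lemma identity_triangle:
  assumes "X \<in> objs S" "is_zero_object S Z"
  shows "triangle X X Z (ident S X) (zerom S X Z) (zerom S Z (susp S X))"
proof -
  have Z: "Z \<in> objs S" using assms(2) unfolding is_zero_object_def by blast
  show ?thesis
    unfolding triangle_def
    using exact_identity[OF assms] ident_closed[OF assms(1)] zero_closed[OF assms(1) Z]
      zero_closed[OF Z susp_objs[OF assms(1)]] by blast
qed

lemma triangle_morphism:
  assumes "triangle X Y Z u v w" "triangle X' Y' Z' u' v' w'"
    and "a \<in> Hom S X X'" "b \<in> Hom S Y Y'" "b \<cdot> u = u' \<cdot> a"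
  obtains c where "c \<in> Hom S Z Z'" "c \<cdot> v = v' \<cdot> b" "susp_arr S a \<cdot> w = w' \<cdot> c"
proof -
  note T = triangleD[OF assms(1)] and T' = triangleD[OF assms(2)]
  have st: "src S u = X" "src S v = Y" "src S w = Z" "src S u' = X'" "src S v' = Y'" "src S w' = Z'"
    using T T' by auto
  have "\<exists>c. triangle_map S (u, v, w) (u', v', w') a b c"
    using assms(3-5) by (intro exact_morphism[OF T(4) T'(4)]) (simp_all add: st)
  then obtain c where "triangle_map S (u, v, w) (u', v', w') a b c" ..
  then have "c \<in> Hom S Z Z' \<and> c \<cdot> v = v' \<cdot> b \<and> susp_arr S a \<cdot> w = w' \<cdot> c"
    unfolding triangle_map_def by (simp add: st)
  then show thesis using that by blast
qed

text \<open>The map of triangles from \<open>X = X \<rightarrow> 0\<close> given by the identity and \<open>u\<close> makes \<open>v \<cdot> u\<close> factor through \<open>0\<close>.\<close>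

lemma triangle_cmp_zero:
  assumes "triangle X Y Z u v w"
  shows "v \<cdot> u = zerom S X Z"
proof -
  note T = triangleD[OF assms] and O = triangle_objs[OF assms]
  obtain Z0 where Z0: "is_zero_object S Z0" using zero_object by blast
  have "u \<cdot> ident S X = u \<cdot> ident S X" ..
  then obtain c where c: "c \<in> Hom S Z0 Z" "c \<cdot> zerom S X Z0 = v \<cdot> u"
    using triangle_morphism[OF identity_triangle[OF O(1) Z0] assms ident_closed[OF O(1)] T(1)] by blast
  then show ?thesis using cmp_zero_right[OF c(1) O(1)] by simp
qed

lemma triangle_cmp_zero':
  assumes "triangle X Y Z u v w"
  shows "w \<cdot> v = zerom S Y (susp S X)"
  using triangle_cmp_zero[OF rotate[OF assms]] .

lemma triangle_cmp_zero'':
  assumes "triangle X Y Z u v w"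
  shows "susp_arr S u \<cdot> w = zerom S Z (susp S Y)"
proof -
  note T = triangleD[OF assms]
  have "negm S (susp_arr S u \<cdot> w) = zerom S Z (susp S Y)"
    using triangle_cmp_zero'[OF rotate[OF assms]] cmp_neg_left[OF T(3) susp_Hom[OF T(1)]] by simp
  then show ?thesis using neg_eq_zero_imp_zero cmp_closed[OF T(3) susp_Hom[OF T(1)]] by blast
qed

text \<open>Rotate the triangle of \<open>A = A \<rightarrow> 0\<close> to \<open>A \<rightarrow> 0 \<rightarrow> \<Sigma>A\<close> and map it by \<open>h\<close> and \<open>0\<close>: the third component
  is a factorization of \<open>\<Sigma>h\<close> through \<open>\<Sigma>u\<close>, which desuspends because \<open>\<Sigma>\<close> is fully faithful.\<close>

lemma weak_kernel:
  assumes t: "triangle X Y Z u v w" and h: "h \<in> Hom S A Y" and z: "v \<cdot> h = zerom S A Z"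
  obtains k where "k \<in> Hom S A X" "u \<cdot> k = h"
proof -
  note T = triangleD[OF t] and O = triangle_objs[OF t]
  have A: "A \<in> objs S" using Hom_objs h by blast
  obtain Z0 where Z0: "is_zero_object S Z0" using zero_object by blast
  then have Z0o: "Z0 \<in> objs S" unfolding is_zero_object_def by blast
  have "zerom S Z0 Z \<cdot> zerom S A Z0 = v \<cdot> h"
    using z cmp_zero_left[OF zero_closed[OF A Z0o] O(3)] by simp
  then obtain c where c: "c \<in> Hom S (susp S A) (susp S X)"
    and eq: "susp_arr S h \<cdot> negm S (susp_arr S (ident S A)) = negm S (susp_arr S u) \<cdot> c"
    using triangle_morphism[OF rotate[OF identity_triangle[OF A Z0]] rotate[OF t] h
        zero_closed[OF Z0o O(3)]] by blast
  obtain k where k: "k \<in> Hom S A X" "susp_arr S k = c" using susp_full[OF c A O(1)] by blast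
  have sA: "ident S (susp S A) \<in> Hom S (susp S A) (susp S A)" using ident_closed susp_objs A by blast
  have "negm S (susp_arr S h) = negm S (susp_arr S (u \<cdot> k))"
    using eq cmp_neg_right[OF sA susp_Hom[OF h]] cmp_neg_left[OF c susp_Hom[OF T(1)]]
      cmp_ident_right[OF susp_Hom[OF h]] susp_ident[OF A] susp_cmp[OF k(1) T(1)] k(2) by simp
  then have "susp_arr S h = susp_arr S (u \<cdot> k)"
    by (rule neg_inject[OF susp_Hom[OF h] susp_Hom[OF cmp_closed[OF k(1) T(1)]]])
  then have "u \<cdot> k = h" using susp_faithful[OF h cmp_closed[OF k(1) T(1)]] by simp
  then show thesis using that k by blast
qed

text \<open>Dually, \<open>h\<close> is the middle component of a map to the triangle \<open>0 \<rightarrow> A = A\<close>. That triangle is exact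
  because its rotation is the identity triangle of \<open>A\<close>, with \<open>\<Sigma>0\<close> as zero object.\<close>

lemma weak_cokernel:
  assumes t: "triangle X Y Z u v w" and h: "h \<in> Hom S Y A" and z: "h \<cdot> u = zerom S X A"
  obtains k where "k \<in> Hom S Z A" "k \<cdot> v = h"
proof -
  note T = triangleD[OF t] and O = triangle_objs[OF t]
  have A: "A \<in> objs S" using Hom_objs h by blast
  obtain Z0 where Z0: "is_zero_object S Z0" using zero_object by blast
  then have Z0o: "Z0 \<in> objs S" unfolding is_zero_object_def by blast
  have z0: "zerom S Z0 A \<in> Hom S Z0 A" "zerom S A (susp S Z0) \<in> Hom S A (susp S Z0)"
    using zero_closed A Z0o susp_objs by blast+
  have "negm S (susp_arr S (zerom S Z0 A)) = zerom S (susp S Z0) (susp S A)"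
    using susp_zero neg_zero susp_objs A Z0o by simp
  then have "(ident S A, zerom S A (susp S Z0), negm S (susp_arr S (zerom S Z0 A))) \<in> exact_triangles S"
    using exact_identity[OF A susp_zero_object[OF Z0]] by simp
  moreover have "is_triangle S (zerom S Z0 A) (ident S A) (zerom S A (susp S Z0))"
    unfolding is_triangle_def using z0 ident_closed[OF A] by blast
  ultimately have t': "triangle Z0 A A (zerom S Z0 A) (ident S A) (zerom S A (susp S Z0))"
    unfolding triangle_def using exact_rotation z0 ident_closed[OF A] by blast
  have "h \<cdot> u = zerom S Z0 A \<cdot> zerom S X Z0"
    using z cmp_zero_left[OF zero_closed[OF O(1) Z0o] A] by simp
  then obtain c where c: "c \<in> Hom S Z A" "c \<cdot> v = ident S A \<cdot> h"
    using triangle_morphism[OF t t' zero_closed[OF O(1) Z0o] h] by blast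
  then show thesis using that cmp_ident_left[OF h] by simp
qed

text \<open>Completing both squares gives maps between the third vertices whose composite \<open>g\<close> on \<open>Z\<close> satisfies
  \<open>g \<cdot> v = v\<close> and \<open>w \<cdot> g = w\<close>. Hence \<open>g - 1\<close> factors through \<open>w\<close> and is killed by \<open>w\<close>, so it squares to
  zero and \<open>g\<close> is invertible.\<close>

lemma triangle_third_retract:
  assumes t: "triangle X Y Z u v w" and t': "triangle X' Y' Z' u' v' w'"
    and a: "a \<in> Hom S X X'" and a': "a' \<in> Hom S X' X" and aa: "a' \<cdot> a = ident S X"
    and b: "b \<in> Hom S Y Y'" and b': "b' \<in> Hom S Y' Y" and bb: "b' \<cdot> b = ident S Y"
    and sq: "b \<cdot> u = u' \<cdot> a" and sq': "b' \<cdot> u' = u \<cdot> a'"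
  shows "is_retract S Z Z'"
proof -
  note T = triangleD[OF t] and T' = triangleD[OF t'] and O = triangle_objs[OF t]
  obtain c where c: "c \<in> Hom S Z Z'" "c \<cdot> v = v' \<cdot> b" "susp_arr S a \<cdot> w = w' \<cdot> c"
    using triangle_morphism[OF t t' a b sq] by blast
  obtain c' where c': "c' \<in> Hom S Z' Z" "c' \<cdot> v' = v \<cdot> b'" "susp_arr S a' \<cdot> w' = w \<cdot> c'"
    using triangle_morphism[OF t' t a' b' sq'] by blast
  define g where "g = c' \<cdot> c"
  have g: "g \<in> Hom S Z Z" unfolding g_def using cmp_closed c c' by blast
  have "g \<cdot> v = c' \<cdot> (v' \<cdot> b)" unfolding g_def using cmp_assoc[OF T(2) c(1) c'(1)] c(2) by simp
  also have "\<dots> = (v \<cdot> b') \<cdot> b" using cmp_assoc[OF b T'(2) c'(1)] c'(2) by simp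
  also have "\<dots> = v" using cmp_assoc[OF b b' T(2)] bb cmp_ident_right[OF T(2)] by simp
  finally have gv: "g \<cdot> v = v" .
  have "w \<cdot> g = (susp_arr S a' \<cdot> w') \<cdot> c"
    unfolding g_def using cmp_assoc[OF c(1) c'(1) T(3)] c'(3) by simp
  also have "\<dots> = susp_arr S a' \<cdot> (susp_arr S a \<cdot> w)"
    using cmp_assoc[OF c(1) T'(3) susp_Hom[OF a']] c(3) by simp
  also have "\<dots> = w"
    using cmp_assoc[OF T(3) susp_Hom[OF a] susp_Hom[OF a']] susp_cmp[OF a a'] aa susp_ident[OF O(1)]
      cmp_ident_left[OF T(3)] by simp
  finally have wg: "w \<cdot> g = w" .
  define n where "n = g \<oplus>\<^sub>m negm S (ident S Z)"
  have id: "ident S Z \<in> Hom S Z Z" using ident_closed O by blast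
  have nid: "negm S (ident S Z) \<in> Hom S Z Z" using neg_closed id .
  have n: "n \<in> Hom S Z Z" unfolding n_def using add_closed g nid by blast
  have nv: "n \<cdot> v = zerom S Y Z"
    unfolding n_def using cmp_add_left[OF T(2) g nid] gv cmp_neg_left[OF T(2) id]
      cmp_ident_left[OF T(2)] add_neg(1)[OF T(2)] by simp
  have wn: "w \<cdot> n = zerom S Z (susp S X)"
    unfolding n_def using cmp_add_right[OF g nid T(3)] wg cmp_neg_right[OF id T(3)]
      cmp_ident_right[OF T(3)] add_neg(1)[OF T(3)] by simp
  obtain k where k: "k \<in> Hom S (susp S X) Z" "k \<cdot> w = n"
    using weak_cokernel[OF rotate[OF t] n nv] by blast
  have "n \<cdot> n = k \<cdot> (w \<cdot> n)" using cmp_assoc[OF n T(3) k(1)] k(2) by simp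
  also have "\<dots> = zerom S Z Z" using wn cmp_zero_right[OF k(1) O(3)] by simp
  finally obtain l where l: "l \<in> Hom S Z Z" "l \<cdot> g = ident S Z"
    using unipotent_imp_left_invertible[OF g n_def] by blast
  have "(l \<cdot> c') \<cdot> c = ident S Z" using l(2) cmp_assoc[OF c(1) c'(1) l(1)] unfolding g_def by simp
  moreover have "l \<cdot> c' \<in> Hom S Z' Z" using cmp_closed c'(1) l(1) .
  ultimately show ?thesis unfolding is_retract_def using c(1) O(3) by blast
qed

end

section \<open>Stable projective classes\<close>

locale stable_projective_class = triangulated_category S
  for S :: "('o, 'm, 'z) triangulated_data_scheme" (structure) +
  fixes \<P> :: "'o set" and \<I> :: "'m set"
  assumes projective: "projective_class S \<P> \<I>"
    and stable: "stable_class S \<P> \<I>"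
begin

lemma proj_obj: "P \<in> \<P> \<Longrightarrow> P \<in> objs S"
  using projective unfolding projective_class_def proj_objs_def by blast

lemma susp_proj: "P \<in> \<P> \<Longrightarrow> susp S P \<in> \<P>"
  and desusp_proj: "P \<in> \<P> \<Longrightarrow> desusp S P \<in> \<P>"
  using stable unfolding stable_class_def by blast+

lemma retract_proj:
  assumes ret: "is_retract S A P" and P: "P \<in> \<P>"
  shows "A \<in> \<P>"
proof -
  obtain i r where ir: "i \<in> Hom S A P" "r \<in> Hom S P A" "r \<cdot> i = ident S A"
    using ret unfolding is_retract_def by blast
  have A: "A \<in> objs S" using Hom_objs ir by blast
  have "f \<cdot> h = zerom S A (tgt S f)" if f: "f \<in> \<I>" and h: "h \<in> Hom S A (src S f)" for f h
  proof -
    have fH: "f \<in> Hom S (src S f) (tgt S f)"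
      using f projective unfolding projective_class_def null_maps_def Hom_def by blast
    have hr: "h \<cdot> r \<in> Hom S P (src S f)" using cmp_closed ir(2) h .
    have "P \<in> proj_objs S \<I>" using projective P unfolding projective_class_def by blast
    then have z: "f \<cdot> (h \<cdot> r) = zerom S P (tgt S f)" using f hr unfolding proj_objs_def by blast
    have "f \<cdot> h = f \<cdot> ((h \<cdot> r) \<cdot> i)"
      using cmp_assoc[OF ir(1,2) h] ir(3) cmp_ident_right[OF h] by simp
    also have "\<dots> = zerom S A (tgt S f)"
      using cmp_assoc[OF ir(1) hr fH] z cmp_zero_left[OF ir(1)] Hom_objs(2)[OF fH] by simp
    finally show ?thesis .
  qed
  then have "A \<in> proj_objs S \<I>" unfolding proj_objs_def using A by blast
  then show ?thesis using projective unfolding projective_class_def by blast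
qed

lemma retract_desusp_susp: "A \<in> objs S \<Longrightarrow> is_retract S A (desusp S (susp S A))"
  unfolding is_retract_def by (rule unit_iso) (blast dest: unit_pairD)

lemma retract_susp_desusp: "A \<in> objs S \<Longrightarrow> is_retract S A (susp S (desusp S A))"
  unfolding is_retract_def by (rule counit_iso) (blast dest: counit_pairD)

lemma proj_if_susp_proj: "A \<in> objs S \<Longrightarrow> susp S A \<in> \<P> \<Longrightarrow> A \<in> \<P>"
  using retract_desusp_susp retract_proj desusp_proj by blast

text \<open>Three rotations of the triangle on \<open>\<Sigma>\<^sup>-\<^sup>1v\<close> give a triangle on \<open>- \<Sigma>\<Sigma>\<^sup>-\<^sup>1v\<close>, which the counit identifies
  with \<open>v\<close> once one of its components is negated. So \<open>\<Sigma>D\<close> is a retract of \<open>Q\<close>, and \<open>\<P>\<close> is closed under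
  retracts and contains \<open>D\<close> as soon as it contains \<open>\<Sigma>D\<close>.\<close>

lemma desusp_cofibre_proj:
  assumes t: "triangle X Y Q v w x" and Q: "Q \<in> \<P>"
    and t': "triangle (desusp S X) (desusp S Y) D (desusp_arr S v) d1 d2"
  shows "D \<in> \<P>"
proof -
  note T = triangleD[OF t] and O = triangle_objs[OF t]
  obtain \<epsilon> \<delta> where "counit_pair \<epsilon> \<delta>" by (rule counit_iso)
  note u = counit_pairD[OF this]
  note eX = u(1)[OF O(1)] and eY = u(1)[OF O(2)] and dX = u(2)[OF O(1)] and dY = u(2)[OF O(2)]
  define V where "V = susp_arr S (desusp_arr S v)"
  have V: "V \<in> Hom S (susp S (desusp S X)) (susp S (desusp S Y))"
    unfolding V_def using susp_Hom desusp_Hom T(1) by blast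
  \<comment> \<open>The sign on the vertex \<open>Y\<close> absorbs the one produced by the odd number of rotations.\<close>
  have "is_retract S (susp S D) Q"
  proof (rule triangle_third_retract[OF rotate[OF rotate[OF rotate[OF t']]] t])
    show "\<epsilon> X \<in> Hom S (susp S (desusp S X)) X" "\<delta> X \<in> Hom S X (susp S (desusp S X))"
      "\<delta> X \<cdot> \<epsilon> X = ident S (susp S (desusp S X))"
      using u O by blast+
    show "negm S (\<epsilon> Y) \<in> Hom S (susp S (desusp S Y)) Y"
      "negm S (\<delta> Y) \<in> Hom S Y (susp S (desusp S Y))"
      using u O neg_closed by blast+
    have "negm S (\<delta> Y) \<cdot> negm S (\<epsilon> Y) = negm S (negm S (\<delta> Y \<cdot> \<epsilon> Y))"
      using cmp_neg_right[OF eY neg_closed[OF dY]] cmp_neg_left[OF eY dY] by simp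
    also have "\<dots> = ident S (susp S (desusp S Y))"
      using neg_neg[OF cmp_closed[OF eY dY]] u(4)[OF O(2)] by simp
    finally show "negm S (\<delta> Y) \<cdot> negm S (\<epsilon> Y) = ident S (susp S (desusp S Y))" .
    have "negm S (\<epsilon> Y) \<cdot> negm S V = \<epsilon> Y \<cdot> V"
      using cmp_neg_right[OF V neg_closed[OF eY]] cmp_neg_left[OF V eY]
        neg_neg[OF cmp_closed[OF V eY]] by simp
    then show "negm S (\<epsilon> Y) \<cdot> negm S (susp_arr S (desusp_arr S v)) = v \<cdot> \<epsilon> X"
      using u(5)[OF T(1)] unfolding V_def by simp
    show "negm S (\<delta> Y) \<cdot> v = negm S (susp_arr S (desusp_arr S v)) \<cdot> \<delta> X"
      using cmp_neg_left[OF T(1) dY] cmp_neg_left[OF dX V] u(6)[OF T(1)] unfolding V_def by simp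
  qed
  then show ?thesis using retract_proj Q proj_if_susp_proj triangle_objs(3)[OF t'] by blast
qed

section \<open>Length\<close>

lemma length_class_retract:
  assumes "is_retract S A B" "B \<in> length_class S \<P> (Suc n)"
  shows "A \<in> length_class S \<P> (Suc n)"
proof (cases n)
  case 0
  then show ?thesis using assms retract_proj by simp
next
  case (Suc k)
  then show ?thesis using assms retract_trans[OF assms(1)] by simp blast
qed

text \<open>For \<open>n > 0\<close> this is the inductive clause of length. For \<open>n = 0\<close> the object \<open>U\<close> is zero, so \<open>v\<close> is an
  isomorphism: it has a section \<open>s\<close> because \<open>w = 0\<close>, and \<open>s \<cdot> v - 1\<close> is killed by \<open>v\<close>, so it factors through
  \<open>U\<close>.\<close>

lemma length_class_extend:
  assumes t: "triangle U V Q u v w" and U: "U \<in> length_class S \<P> n" and Q: "Q \<in> \<P>"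
  shows "V \<in> length_class S \<P> (Suc n)"
proof (cases n)
  case (Suc k)
  have "cofibre_sequence S u v" using triangleD(4)[OF t] unfolding cofibre_sequence_def by blast
  then show ?thesis
    using Suc U Q triangleD(1,2)[OF t] retract_refl[OF triangle_objs(2)[OF t]] by simp blast
next
  case 0
  note T = triangleD[OF t] and O = triangle_objs[OF t]
  have Uz: "is_zero_object S U" using U 0 by simp
  have idQ: "ident S Q \<in> Hom S Q Q" and idV: "ident S V \<in> Hom S V V" using ident_closed O by blast+
  have "w \<cdot> ident S Q = zerom S Q (susp S U)"
    using to_zero_object[OF susp_zero_object[OF Uz]] cmp_closed[OF idQ T(3)] by blast
  then obtain s where s: "s \<in> Hom S Q V" "v \<cdot> s = ident S Q"
    using weak_kernel[OF rotate[OF t] idQ] by blast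
  define g where "g = (s \<cdot> v) \<oplus>\<^sub>m negm S (ident S V)"
  have sv: "s \<cdot> v \<in> Hom S V V" using cmp_closed[OF T(2) s(1)] .
  have g: "g \<in> Hom S V V" unfolding g_def using add_closed sv neg_closed idV by blast
  have "v \<cdot> g = (v \<cdot> (s \<cdot> v)) \<oplus>\<^sub>m negm S v"
    unfolding g_def using cmp_add_right[OF sv neg_closed[OF idV] T(2)]
      cmp_neg_right[OF idV T(2)] cmp_ident_right[OF T(2)] by simp
  also have "v \<cdot> (s \<cdot> v) = v" using cmp_assoc[OF T(2) s(1) T(2)] s(2) cmp_ident_left[OF T(2)] by simp
  also have "v \<oplus>\<^sub>m negm S v = zerom S V Q" using add_neg T(2) by blast
  finally obtain k where k: "k \<in> Hom S V U" "u \<cdot> k = g" using weak_kernel[OF t g] by blast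
  have "g = zerom S V V"
    using k from_zero_object[OF Uz T(1)] cmp_zero_left[OF k(1) O(2)] by simp
  then have "s \<cdot> v = ident S V" using add_neg_eq_zero_imp_eq[OF sv idV] unfolding g_def by simp
  then have "is_retract S V Q" unfolding is_retract_def using s T O by blast
  then show ?thesis using retract_proj Q 0 by simp
qed

text \<open>An Adams tower of height \<open>m\<close>: the cofibre sequences \<open>P \<rightarrow> X \<rightarrow> Y\<close> are recorded in the rotated form
  \<open>X \<rightarrow> Y \<rightarrow> \<Sigma>P\<close>, so that the object of \<open>\<P>\<close> is the cofibre.\<close>

primrec tower :: "nat \<Rightarrow> 'o \<Rightarrow> bool" where
  "tower 0 X \<longleftrightarrow> is_zero_object S X"
| "tower (Suc m) X \<longleftrightarrow> (\<exists>Y Q v w x. Q \<in> \<P> \<and> triangle X Y Q v w x \<and> tower m Y)"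

text \<open>\<open>Z\<close> is the desuspended end of the tower and \<open>g\<close> the composite of \<open>f\<close> with the desuspended tower maps.
  The octahedral axiom bounds the growth of the cofibre by one step of length for each of these maps.
  Building up from the source keeps the new object of \<open>\<P>\<close> on the right of each extension, as in the definition
  of length.\<close>

lemma tower_composite_cofibre:
  assumes "tower m X" and "triangle A (desusp S X) B f f1 f2" and "B \<in> length_class S \<P> n"
  shows "\<exists>Z B' g g1 g2. is_zero_object S Z \<and> triangle A Z B' g g1 g2 \<and> B' \<in> length_class S \<P> (n + m)"
  using assms
proof (induction m arbitrary: X B f f1 f2 n)
  case 0
  then have "is_zero_object S (desusp S X)" using desusp_zero_object by simp
  then have "is_zero_object S (desusp S X) \<and> triangle A (desusp S X) B f f1 f2 \<and>
      B \<in> length_class S \<P> (n + 0)" using 0 by simp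
  then show ?case by blast
next
  case (Suc m)
  obtain Y Q v w x where st: "Q \<in> \<P>" "triangle X Y Q v w x" "tower m Y"
    using Suc.prems(1) by auto
  note F = triangleD[OF Suc.prems(2)]
  have V: "desusp_arr S v \<in> Hom S (desusp S X) (desusp S Y)"
    using desusp_Hom triangleD(1)[OF st(2)] .
  obtain D d1 d2 where D: "triangle (desusp S X) (desusp S Y) D (desusp_arr S v) d1 d2"
    using completion[OF V] .
  have DP: "D \<in> \<P>" using desusp_cofibre_proj[OF st(2,1) D] .
  have H: "desusp_arr S v \<cdot> f \<in> Hom S A (desusp S Y)" using cmp_closed[OF F(1) V] .
  obtain B' h1 h2 where B': "triangle A (desusp S Y) B' (desusp_arr S v \<cdot> f) h1 h2"
    using completion[OF H] .
  obtain a b where ab: "a \<in> Hom S B B'" "b \<in> Hom S B' D"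
    "(a, b, susp_arr S f1 \<cdot> d2) \<in> exact_triangles S"
    using exact_octahedron[OF F(1) V F(4) triangleD(4)[OF D] triangleD(4)[OF B']]
    unfolding Hom_src_tgt(2)[OF F(2)] Hom_src_tgt(2)[OF triangleD(2)[OF D]]
      Hom_src_tgt(2)[OF triangleD(2)[OF B']] by blast
  have "susp_arr S f1 \<cdot> d2 \<in> Hom S D (susp S B)"
    using cmp_closed[OF triangleD(3)[OF D] susp_Hom[OF F(2)]] .
  then have "triangle B B' D a b (susp_arr S f1 \<cdot> d2)" unfolding triangle_def using ab by blast
  then have "B' \<in> length_class S \<P> (Suc n)" using length_class_extend Suc.prems(3) DP by blast
  from Suc.IH[OF st(3) B' this] show ?case by simp
qed

text \<open>Take the identity of \<open>\<Sigma>\<^sup>-\<^sup>1X\<close> as the starting map; its cofibre is zero, of length \<open>0\<close>. The final cofibre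
  \<open>B'\<close> of \<open>\<Sigma>\<^sup>-\<^sup>1X \<rightarrow> 0\<close> maps to \<open>\<Sigma>\<Sigma>\<^sup>-\<^sup>1X\<close> by a split epimorphism, so \<open>X\<close> is a retract of it.\<close>

lemma tower_imp_length_class:
  assumes t: "tower (Suc m) X" and X: "X \<in> objs S"
  shows "X \<in> length_class S \<P> (Suc m)"
proof -
  obtain Z0 where Z0: "is_zero_object S Z0" using zero_object by blast
  have W: "desusp S X \<in> objs S" using desusp_objs X .
  obtain Z B' g g1 g2 where Z: "is_zero_object S Z" and B: "triangle (desusp S X) Z B' g g1 g2"
    and len: "B' \<in> length_class S \<P> (Suc m)"
    using tower_composite_cofibre[OF t identity_triangle[OF W Z0], of 0] Z0 by auto
  note T = triangleD[OF B]
  have id: "ident S (susp S (desusp S X)) \<in> Hom S (susp S (desusp S X)) (susp S (desusp S X))"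
    using ident_closed susp_objs W by blast
  have "negm S (susp_arr S g) \<cdot> ident S (susp S (desusp S X)) = zerom S (susp S (desusp S X)) (susp S Z)"
    using to_zero_object[OF susp_zero_object[OF Z]]
      cmp_closed[OF id neg_closed[OF susp_Hom[OF T(1)]]] by blast
  then obtain s where "s \<in> Hom S (susp S (desusp S X)) B'" "g2 \<cdot> s = ident S (susp S (desusp S X))"
    using weak_kernel[OF rotate[OF rotate[OF B]] id] by blast
  then have "is_retract S (susp S (desusp S X)) B'"
    unfolding is_retract_def using T(3) susp_objs W by blast
  then show ?thesis
    using length_class_retract len retract_trans retract_susp_desusp[OF X] by blast
qed

section \<open>Projective resolutions\<close>

definition proj_epi where
  "proj_epi f \<longleftrightarrow> (\<forall>Q \<in> \<P>. \<forall>h \<in> Hom S Q (tgt S f). \<exists>k \<in> Hom S Q (src S f). f \<cdot> k = h)"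

definition proj_monic where
  "proj_monic f \<longleftrightarrow>
    (\<forall>Q \<in> \<P>. \<forall>h \<in> Hom S Q (src S f). f \<cdot> h = zerom S Q (tgt S f) \<longrightarrow> h = zerom S Q (src S f))"

definition proj_exact where
  "proj_exact f g \<longleftrightarrow> (\<forall>Q \<in> \<P>. \<forall>h \<in> Hom S Q (src S g).
     g \<cdot> h = zerom S Q (tgt S g) \<longleftrightarrow> (\<exists>k \<in> Hom S Q (src S f). f \<cdot> k = h))"

lemma proj_monicD:
  assumes "proj_monic f" "f \<in> Hom S A B" "Q \<in> \<P>" "h \<in> Hom S Q A" "f \<cdot> h = zerom S Q B"
  shows "h = zerom S Q A"
  using assms unfolding proj_monic_def by simp

lemma proj_monic_cancel:
  assumes m: "proj_monic f" and f: "f \<in> Hom S A B" and Q: "Q \<in> \<P>"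
    and h: "h \<in> Hom S Q A" and k: "k \<in> Hom S Q A" and eq: "f \<cdot> h = f \<cdot> k"
  shows "h = k"
proof (rule add_neg_eq_zero_imp_eq[OF h k])
  have "f \<cdot> (h \<oplus>\<^sub>m negm S k) = zerom S Q B"
    using cmp_add_right[OF h neg_closed[OF k] f] cmp_neg_right[OF k f] eq
      add_neg(1)[OF cmp_closed[OF k f]] by simp
  then show "h \<oplus>\<^sub>m negm S k = zerom S Q A"
    using proj_monicD[OF m f Q] add_closed h neg_closed k by blast
qed

text \<open>A test map from \<open>Q\<close> to \<open>\<Sigma>A\<close> corresponds to one from \<open>\<Sigma>\<^sup>-\<^sup>1Q\<close> to \<open>A\<close>, and \<open>\<Sigma>\<^sup>-\<^sup>1Q\<close> is again in \<open>\<P>\<close>.\<close>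

lemma proj_monic_susp:
  assumes m: "proj_monic f" and f: "f \<in> Hom S A B"
  shows "proj_monic (susp_arr S f)"
proof -
  have "h = zerom S Q (susp S A)"
    if Q: "Q \<in> \<P>" and h: "h \<in> Hom S Q (susp S A)" and z: "susp_arr S f \<cdot> h = zerom S Q (susp S B)" for Q h
  proof -
    have Qo: "Q \<in> objs S" using proj_obj Q .
    have W: "desusp S Q \<in> objs S" using desusp_objs Qo .
    obtain \<delta> \<epsilon> where e: "\<epsilon> \<in> Hom S (susp S (desusp S Q)) Q" "\<delta> \<in> Hom S Q (susp S (desusp S Q))"
      "\<epsilon> \<cdot> \<delta> = ident S Q"
      using retract_susp_desusp[OF Qo] unfolding is_retract_def by blast
    obtain k where k: "k \<in> Hom S (desusp S Q) A" "susp_arr S k = h \<cdot> \<epsilon>"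
      using susp_full[OF cmp_closed[OF e(1) h] W Hom_objs(1)[OF f]] .
    have fk: "f \<cdot> k \<in> Hom S (desusp S Q) B" using cmp_closed[OF k(1) f] .
    have "susp_arr S (f \<cdot> k) = (susp_arr S f \<cdot> h) \<cdot> \<epsilon>"
      using susp_cmp[OF k(1) f] k(2) cmp_assoc[OF e(1) h susp_Hom[OF f]] by simp
    also have "\<dots> = susp_arr S (zerom S (desusp S Q) B)"
      using z cmp_zero_left[OF e(1)] susp_objs susp_zero W Hom_objs(2)[OF f] by simp
    finally have "f \<cdot> k = zerom S (desusp S Q) B"
      using susp_faithful[OF fk] zero_closed W Hom_objs(2)[OF f] by blast
    then have "k = zerom S (desusp S Q) A" using proj_monicD[OF m f desusp_proj[OF Q] k(1)] by blast
    then have "h \<cdot> \<epsilon> = zerom S Q (susp S A) \<cdot> \<epsilon>"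
      using k(2) susp_zero W Hom_objs(1)[OF f] cmp_zero_left[OF e(1)] susp_objs by simp
    then show ?thesis
      using cancel_right[OF h _ e] zero_closed Qo susp_objs Hom_objs(1)[OF f] by blast
  qed
  then show ?thesis unfolding proj_monic_def using Hom_src_tgt[OF susp_Hom[OF f]] by simp
qed

text \<open>A test map \<open>y\<close> killed by \<open>w\<close> lifts to \<open>X\<close>, hence to \<open>P\<close> since \<open>e\<close> is epi on \<open>\<P>\<close>, and \<open>v \<cdot> e = 0\<close>.\<close>

lemma cofibre_of_proj_epi:
  assumes t: "triangle P X Y e v w" and epi: "proj_epi e"
  shows "proj_monic w"
proof -
  note T = triangleD[OF t] and O = triangle_objs[OF t]
  have "y = zerom S Q Y" if Q: "Q \<in> \<P>" and y: "y \<in> Hom S Q Y" and z: "w \<cdot> y = zerom S Q (susp S P)" for Q y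
  proof -
    obtain x where x: "x \<in> Hom S Q X" "v \<cdot> x = y" using weak_kernel[OF rotate[OF t] y z] .
    obtain p where p: "p \<in> Hom S Q P" "e \<cdot> p = x"
      using epi Q x(1) T(1) unfolding proj_epi_def by auto
    have "y = (v \<cdot> e) \<cdot> p" using cmp_assoc[OF p(1) T(1,2)] p x by simp
    then show ?thesis using triangle_cmp_zero[OF t] cmp_zero_left[OF p(1) O(3)] by simp
  qed
  then show ?thesis unfolding proj_monic_def using T(3) by simp
qed

text \<open>A projective resolution tested on the objects of \<open>\<P>\<close> in degree \<open>0\<close> only. By stability the shifts of an
  object of \<open>\<P>\<close> are themselves in \<open>\<P>\<close>, so this amounts to graded exactness.\<close>

definition resolves where
  "resolves X m P e d \<longleftrightarrow> (\<forall>s\<le>m. P s \<in> \<P>) \<and> e \<in> Hom S (P 0) X \<and>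
    (\<forall>s<m. d s \<in> Hom S (P (Suc s)) (susp S (P s))) \<and>
    proj_epi e \<and> (0 < m \<longrightarrow> proj_exact (d 0) (susp_arr S e)) \<and>
    (\<forall>s. Suc s < m \<longrightarrow> proj_exact (d (Suc s)) (susp_arr S (d s))) \<and>
    proj_monic (case m of 0 \<Rightarrow> e | Suc k \<Rightarrow> d k)"

lemma kernel_hom_group:
  "kernel (hom_group S Q A) (hom_group S Q B) f = {h \<in> Hom S Q A. f h = zerom S Q B}"
  unfolding kernel_def hom_group_def by simp

lemma inj_on_imp_zero:
  assumes "inj_on (\<lambda>h. f \<cdot> h) (Hom S Q A)" "f \<in> Hom S A B" "h \<in> Hom S Q A" "f \<cdot> h = zerom S Q B"
  shows "h = zerom S Q A"
proof -
  have "f \<cdot> h = f \<cdot> zerom S Q A"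
    using assms(4) cmp_zero_right[OF assms(2) Hom_objs(1)[OF assms(3)]] by simp
  then show ?thesis
    using inj_onD[OF assms(1)] assms(3) zero_closed[OF Hom_objs[OF assms(3)]] by blast
qed

lemma projective_resolution_imp_resolves:
  assumes r: "projective_resolution S \<P> X m P e d"
  shows "resolves X m P e d"
proof -
  have P: "\<forall>s\<le>m. P s \<in> \<P>" and e: "e \<in> Hom S (P 0) X"
    and d: "\<forall>s<m. d s \<in> Hom S (P (Suc s)) (susp S (P s))"
    using r unfolding projective_resolution_def by blast+
  have ex: "(\<lambda>h. e \<cdot> h) ` Hom S Q (P 0) = Hom S Q X"
    "0 < m \<Longrightarrow> (\<lambda>h. d 0 \<cdot> h) ` Hom S Q (P 1) =
       {h \<in> Hom S Q (susp S (P 0)). susp_arr S e \<cdot> h = zerom S Q (susp S X)}"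
    "\<And>s. Suc s < m \<Longrightarrow> (\<lambda>h. d (Suc s) \<cdot> h) ` Hom S Q (P (Suc (Suc s))) =
       {h \<in> Hom S Q (susp S (P (Suc s))). susp_arr S (d s) \<cdot> h = zerom S Q (susp S (susp S (P s)))}"
    "case m of 0 \<Rightarrow> inj_on (\<lambda>h. e \<cdot> h) (Hom S Q (P 0))
       | Suc k \<Rightarrow> inj_on (\<lambda>h. d k \<cdot> h) (Hom S Q (P m))" if "Q \<in> \<P>" for Q
  proof -
    have "susp_pow S 0 Q = Q" unfolding susp_pow_def by simp
    note * = r[unfolded projective_resolution_def kernel_hom_group Let_def, THEN conjunct2,
      THEN conjunct2, THEN conjunct2, rule_format, OF that, of 0, unfolded this]
    show "(\<lambda>h. e \<cdot> h) ` Hom S Q (P 0) = Hom S Q X"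
      "0 < m \<Longrightarrow> (\<lambda>h. d 0 \<cdot> h) ` Hom S Q (P 1) =
       {h \<in> Hom S Q (susp S (P 0)). susp_arr S e \<cdot> h = zerom S Q (susp S X)}"
      "\<And>s. Suc s < m \<Longrightarrow> (\<lambda>h. d (Suc s) \<cdot> h) ` Hom S Q (P (Suc (Suc s))) =
       {h \<in> Hom S Q (susp S (P (Suc s))). susp_arr S (d s) \<cdot> h = zerom S Q (susp S (susp S (P s)))}"
      "case m of 0 \<Rightarrow> inj_on (\<lambda>h. e \<cdot> h) (Hom S Q (P 0))
       | Suc k \<Rightarrow> inj_on (\<lambda>h. d k \<cdot> h) (Hom S Q (P m))"
      using * by blast+
  qed
  have "proj_epi e"
    unfolding proj_epi_def Hom_src_tgt[OF e]
  proof (intro ballI)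
    fix Q h assume "Q \<in> \<P>" "h \<in> Hom S Q X"
    then have "h \<in> (\<lambda>k. e \<cdot> k) ` Hom S Q (P 0)" using ex(1) by simp
    then show "\<exists>k \<in> Hom S Q (P 0). e \<cdot> k = h" by blast
  qed
  moreover have "proj_exact (d 0) (susp_arr S e)" if "0 < m"
  proof -
    have d0: "d 0 \<in> Hom S (P 1) (susp S (P 0))" using d that by auto
    show ?thesis unfolding proj_exact_def Hom_src_tgt[OF d0] Hom_src_tgt[OF susp_Hom[OF e]]
    proof (intro ballI)
      fix Q h assume "Q \<in> \<P>" "h \<in> Hom S Q (susp S (P 0))"
      then have "susp_arr S e \<cdot> h = zerom S Q (susp S X) \<longleftrightarrow> h \<in> (\<lambda>k. d 0 \<cdot> k) ` Hom S Q (P 1)"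
        using ex(2)[OF _ that] by simp
      then show "susp_arr S e \<cdot> h = zerom S Q (susp S X) \<longleftrightarrow> (\<exists>k \<in> Hom S Q (P 1). d 0 \<cdot> k = h)"
        by blast
    qed
  qed
  moreover have "proj_exact (d (Suc s)) (susp_arr S (d s))" if "Suc s < m" for s
  proof -
    have d0: "d s \<in> Hom S (P (Suc s)) (susp S (P s))"
      "d (Suc s) \<in> Hom S (P (Suc (Suc s))) (susp S (P (Suc s)))" using d that by auto
    show ?thesis
      unfolding proj_exact_def Hom_src_tgt[OF d0(2)] Hom_src_tgt[OF susp_Hom[OF d0(1)]]
    proof (intro ballI)
      fix Q h assume "Q \<in> \<P>" "h \<in> Hom S Q (susp S (P (Suc s)))"
      then have "susp_arr S (d s) \<cdot> h = zerom S Q (susp S (susp S (P s))) \<longleftrightarrow>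
          h \<in> (\<lambda>k. d (Suc s) \<cdot> k) ` Hom S Q (P (Suc (Suc s)))"
        using ex(3)[OF _ that] by simp
      then show "susp_arr S (d s) \<cdot> h = zerom S Q (susp S (susp S (P s))) \<longleftrightarrow>
          (\<exists>k \<in> Hom S Q (P (Suc (Suc s))). d (Suc s) \<cdot> k = h)"
        by blast
    qed
  qed
  moreover have "proj_monic (case m of 0 \<Rightarrow> e | Suc k \<Rightarrow> d k)"
  proof (cases m)
    case 0
    then show ?thesis
      unfolding proj_monic_def using ex(4) inj_on_imp_zero[OF _ e] Hom_src_tgt[OF e] by simp
  next
    case (Suc k)
    then have dk: "d k \<in> Hom S (P (Suc k)) (susp S (P k))" using d by simp
    then show ?thesis
      unfolding proj_monic_def using ex(4) inj_on_imp_zero[OF _ dk] Hom_src_tgt[OF dk] Suc by simp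
  qed
  ultimately show ?thesis unfolding resolves_def using P e d by blast
qed

text \<open>Since \<open>\<Sigma>e \<cdot> d 0 = 0\<close>, the differential \<open>d 0\<close> factors as \<open>w \<cdot> e'\<close>. As \<open>w\<close> and \<open>\<Sigma>w\<close> are injective on
  test maps, composing with them changes no kernels, so exactness of the old complex at \<open>P 0\<close>, at \<open>P 1\<close>
  and at its last term carries over to the new one.\<close>

lemma resolves_shift:
  assumes r: "resolves X (Suc m) P e d" and t: "triangle (P 0) X Y e v w"
  obtains e' where "resolves Y m (\<lambda>s. P (Suc s)) e' (\<lambda>s. d (Suc s))"
proof -
  note T = triangleD[OF t] and O = triangle_objs[OF t]
  have P: "\<And>s. s \<le> Suc m \<Longrightarrow> P s \<in> \<P>"
    and d: "\<And>s. s \<le> m \<Longrightarrow> d s \<in> Hom S (P (Suc s)) (susp S (P s))"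
    and epi: "proj_epi e" and ex0: "proj_exact (d 0) (susp_arr S e)"
    and ex: "\<And>s. s < m \<Longrightarrow> proj_exact (d (Suc s)) (susp_arr S (d s))"
    and mono: "proj_monic (d m)"
    using r unfolding resolves_def by auto
  have w: "proj_monic w" using cofibre_of_proj_epi t epi .
  have d0: "d 0 \<in> Hom S (P 1) (susp S (P 0))" using d[of 0] by simp
  have P1: "P 1 \<in> \<P>" using P[of 1] by simp
  note sE = susp_Hom[OF T(1)]
  have ex0': "susp_arr S e \<cdot> h = zerom S Q (susp S X) \<longleftrightarrow> (\<exists>k \<in> Hom S Q (P 1). d 0 \<cdot> k = h)"
    if "Q \<in> \<P>" "h \<in> Hom S Q (susp S (P 0))" for Q h
    using ex0 that unfolding proj_exact_def Hom_src_tgt[OF d0] Hom_src_tgt[OF sE] by blast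
  \<comment> \<open>Exactness tested on the identity of \<open>P 1\<close>.\<close>
  have "susp_arr S e \<cdot> d 0 = zerom S (P 1) (susp S X)"
    using ex0'[OF P1 d0] cmp_ident_right[OF d0] ident_closed[OF proj_obj[OF P1]] by blast
  then have "negm S (susp_arr S e) \<cdot> d 0 = zerom S (P 1) (susp S X)"
    using cmp_neg_left[OF d0 sE] neg_zero proj_obj[OF P1] susp_objs O(2) by simp
  then obtain e' where e': "e' \<in> Hom S (P 1) Y" "w \<cdot> e' = d 0"
    using weak_kernel[OF rotate[OF rotate[OF t]] d0] by blast
  have epi': "proj_epi e'"
  proof -
    have "\<exists>k \<in> Hom S Q (P 1). e' \<cdot> k = y" if Q: "Q \<in> \<P>" and y: "y \<in> Hom S Q Y" for Q y
    proof -
      have "susp_arr S e \<cdot> (w \<cdot> y) = zerom S Q (susp S X)"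
        using cmp_assoc[OF y T(3) sE] triangle_cmp_zero''[OF t] cmp_zero_left[OF y] susp_objs O(2)
        by simp
      then obtain k where k: "k \<in> Hom S Q (P 1)" "d 0 \<cdot> k = w \<cdot> y"
        using ex0'[OF Q cmp_closed[OF y T(3)]] by blast
      have "w \<cdot> (e' \<cdot> k) = w \<cdot> y" using cmp_assoc[OF k(1) e'(1) T(3)] e'(2) k(2) by simp
      then have "e' \<cdot> k = y"
        using proj_monic_cancel[OF w T(3) Q cmp_closed[OF k(1) e'(1)] y] by blast
      then show ?thesis using k(1) by blast
    qed
    then show ?thesis unfolding proj_epi_def Hom_src_tgt[OF e'(1)] by blast
  qed
  have ex1: "proj_exact (d 1) (susp_arr S e')" if "0 < m"
  proof -
    have sw: "proj_monic (susp_arr S w)" using proj_monic_susp[OF w T(3)] .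
    have "susp_arr S e' \<cdot> h = zerom S Q (susp S Y) \<longleftrightarrow>
        susp_arr S (d 0) \<cdot> h = zerom S Q (susp S (susp S (P 0)))"
      if Q: "Q \<in> \<P>" and h: "h \<in> Hom S Q (susp S (P 1))" for Q h
    proof -
      have "susp_arr S (d 0) \<cdot> h = susp_arr S w \<cdot> (susp_arr S e' \<cdot> h)"
        using susp_cmp[OF e'(1) T(3)] e'(2) cmp_assoc[OF h susp_Hom[OF e'(1)] susp_Hom[OF T(3)]] by simp
      moreover have "susp_arr S e' \<cdot> h = zerom S Q (susp S Y)"
        if "susp_arr S w \<cdot> (susp_arr S e' \<cdot> h) = zerom S Q (susp S (susp S (P 0)))"
        using proj_monicD[OF sw susp_Hom[OF T(3)] Q cmp_closed[OF h susp_Hom[OF e'(1)]] that] .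
      moreover have "susp_arr S w \<cdot> zerom S Q (susp S Y) = zerom S Q (susp S (susp S (P 0)))"
        using cmp_zero_right[OF susp_Hom[OF T(3)] proj_obj[OF Q]] .
      ultimately show ?thesis by metis
    qed
    then show ?thesis using ex[OF that]
      unfolding proj_exact_def Hom_src_tgt[OF susp_Hom[OF d0]] Hom_src_tgt[OF susp_Hom[OF e'(1)]]
      by simp
  qed
  have mono': "proj_monic (case m of 0 \<Rightarrow> e' | Suc k \<Rightarrow> d (Suc k))"
  proof (cases m)
    case 0
    have "h = zerom S Q (P 1)"
      if Q: "Q \<in> \<P>" and h: "h \<in> Hom S Q (P 1)" and z: "e' \<cdot> h = zerom S Q Y" for Q h
    proof -
      have "d 0 \<cdot> h = zerom S Q (susp S (P 0))"
        using cmp_assoc[OF h e'(1) T(3)] e'(2) z cmp_zero_right[OF T(3) proj_obj[OF Q]] by simp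
      then show ?thesis using proj_monicD[OF _ d0 Q h] mono 0 by simp
    qed
    then show ?thesis using 0 unfolding proj_monic_def by (simp add: Hom_src_tgt[OF e'(1)])
  next
    case (Suc k)
    then show ?thesis using mono by simp
  qed
  show thesis
    by (rule that[of e'], unfold resolves_def) (use P d e' epi' ex1 ex mono' in auto)
qed

text \<open>In the base case \<open>e\<close> is both epi and monic on \<open>\<P>\<close>, so any test map to its cofibre \<open>Y\<close> is sent by the
  injective \<open>w\<close> into the zero kernel of \<open>\<Sigma>e\<close>. Hence nothing in \<open>\<P>\<close> detects \<open>Y\<close>, which is where generation
  enters.\<close>

lemma resolves_imp_tower:
  assumes gen: "generates S \<P>"
  shows "resolves X m P e d \<Longrightarrow> tower (Suc m) X"
proof (induction m arbitrary: X P e d)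
  case 0
  then have P0: "P 0 \<in> \<P>" and e: "e \<in> Hom S (P 0) X" and epi: "proj_epi e" and mono: "proj_monic e"
    unfolding resolves_def by auto
  obtain Y v w where t: "triangle (P 0) X Y e v w" using completion[OF e] .
  note T = triangleD[OF t] and O = triangle_objs[OF t]
  have w: "proj_monic w" using cofibre_of_proj_epi t epi .
  have "Hom S Q Y = {zerom S Q Y}" if Q: "Q \<in> \<P>" for Q
  proof -
    have "y = zerom S Q Y" if y: "y \<in> Hom S Q Y" for y
    proof -
      have "susp_arr S e \<cdot> (w \<cdot> y) = zerom S Q (susp S X)"
        using cmp_assoc[OF y T(3) susp_Hom[OF T(1)]] triangle_cmp_zero''[OF t] cmp_zero_left[OF y]
          susp_objs O(2) by simp
      then have "w \<cdot> y = zerom S Q (susp S (P 0))"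
        using proj_monicD[OF proj_monic_susp[OF mono e] susp_Hom[OF e] Q cmp_closed[OF y T(3)]] by blast
      then show ?thesis using proj_monicD[OF w T(3) Q y] by blast
    qed
    then show ?thesis using zero_closed[OF proj_obj[OF Q] O(3)] by blast
  qed
  then have "tower 0 Y" using gen O(3) unfolding generates_def by auto
  then show ?case using rotate[OF t] susp_proj[OF P0] tower.simps(2)[of 0 X] by blast
next
  case (Suc m)
  then have P0: "P 0 \<in> \<P>" and e: "e \<in> Hom S (P 0) X" unfolding resolves_def by auto
  obtain Y v w where t: "triangle (P 0) X Y e v w" using completion[OF e] .
  obtain e' where "resolves Y m (\<lambda>s. P (Suc s)) e' (\<lambda>s. d (Suc s))"
    using resolves_shift[OF Suc.prems t] .
  then have "tower (Suc m) Y" using Suc.IH by blast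
  then show ?case using rotate[OF t] susp_proj[OF P0] tower.simps(2)[of "Suc m" X] by blast
qed

lemma projective_resolution_imp_length_class:
  assumes "generates S \<P>" "projective_resolution S \<P> X m P e d"
  shows "X \<in> length_class S \<P> (Suc m)"
proof (rule tower_imp_length_class)
  have "resolves X m P e d" using projective_resolution_imp_resolves assms(2) .
  then show "tower (Suc m) X" using resolves_imp_tower assms(1) by blast
  show "X \<in> objs S" using assms(2) Hom_objs unfolding projective_resolution_def by blast
qed

end

section \<open>The length bound\<close>

theorem proposition4p7:
  fixes S :: "('o, 'm) triangulated_data"
    and \<P> :: "'o set" and \<I> :: "'m set" and X :: 'o
  assumes "triangulated_category S"
    and "has_coproducts S TYPE('i)"
    and "projective_class S \<P> \<I>"
    and "stable_class S \<P> \<I>"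
    and "generates S \<P>"
    and "X \<in> objs S"
  shows "obj_length S \<P> X \<le> proj_dim S \<P> X + 1"
proof (cases "{enat m |m. \<exists>P e d. projective_resolution S \<P> X m P e d} = {}")
  case True
  have "proj_dim S \<P> X = \<infinity>" unfolding proj_dim_def True by (simp add: Inf_enat_def)
  then show ?thesis by simp
next
  case False
  interpret stable_projective_class S \<P> \<I>
    using assms(1,3,4) by (simp add: stable_projective_class_def stable_projective_class_axioms_def)
  from False have "proj_dim S \<P> X \<in> {enat m |m. \<exists>P e d. projective_resolution S \<P> X m P e d}"
    unfolding proj_dim_def by (meson all_not_in_conv wellorder_InfI)
  then obtain m P e d where m: "proj_dim S \<P> X = enat m" "projective_resolution S \<P> X m P e d"
    by auto
  then have "X \<in> length_class S \<P> (Suc m)"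
    using projective_resolution_imp_length_class assms(5) by blast
  then have "obj_length S \<P> X \<le> enat (Suc m)" unfolding obj_length_def by (blast intro: Inf_lower)
  then show ?thesis using m(1) by (simp add: one_enat_def)
qed

end
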